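(* Let $\mathcal{Y}=\{1,\dots,k\}$, let $L\in\mathbb{R}^{k\times k}$ be a nonnegative task loss matrix, let $F\in\mathbb{R}^{k\times r}$ and $\mathcal{F}=\{F\theta:\theta\in\mathbb{R}^r\}$. Let $K$ be a positive definite kernel on an input space $\mathcal{X}$ with RKHS $\mathcal{H}$ and feature map $\psi:\mathcal{X}\to\mathcal{H}$, and consider score functions $f_W(x)=FW\psi(x)$ where $W:\mathcal{H}\to\mathbb{R}^r$ is a linear operator with finite Hilbert–Schmidt norm $\|W\|_{HS}$. Let $\Phi:\mathbb{R}^k\times\mathcal{Y}\to\mathbb{R}$ be a continuous surrogate loss such that for every $y$, $f\mapsto\Phi(f,y)$ is convex and bounded from below. Let $\mathcal{D}$ be a distribution on $\mathcal{X}\times\mathcal{Y}$ such that $\mathcal{R}^*_{\Phi,\mathcal{F}}=\inf_{f\in\mathcal{F}_{\mathcal{F}}}\mathcal{R}_\Phi(f)$ is attained at some $f^*=f_{W^*}$ with $\|W^*\|_{HS}\le D$. Assume that $\mathbb{E}_{(x,y)\sim\mathcal{D}}\|F^\top g(x,y)\,\psi(x)^\top\|_{HS}^2\le M^2$ for every $W$ with $\|W\|_{HS}\le D$, where $g(x,y)\in\mathbb{R}^k$ is the (sub)gradient of $\Phi(\cdot,y)$ used by the algorithm at $f=f_W(x)$. Let $\check H$ be a convex non-decreasing lower bound of the calibration function $H_{\Phi,L,\mathcal{F}}$. Run ASGD for $N$ steps: with i.i.d. samples $(x^{(t)},y^{(t)})\sim\mathcal{D}$, $W^{(0)}=0$ and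 $$W^{(t)}=\mathrm{Proj}_D\bigl[W^{(t-1)}-\gamma F^\top g(x^{(t)},y^{(t)})\psi(x^{(t)})^\top\bigr],\quad \gamma=\frac{2D}{M\sqrt N},$$ where $g$ is evaluated at $W=W^{(t-1)}$ and $\mathrm{Proj}_D$ is the projection onto the Hilbert–Schmidt ball of radius $D$, and output $\bar f^{(N)}(x)=F\bar W\psi(x)$ with $\bar W=\frac1N\sum_{t=1}^N W^{(t)}$. Then for any $\varepsilon>0$, if $$N>N^*:=\frac{4D^2M^2}{\check H^2(\varepsilon)},$$ the (random) output satisfies $\mathbb{E}[\mathcal{R}_L(\bar f^{(N)})]<\mathcal{R}^*_{L,\mathcal{F}}+\varepsilon$, the expectation being over the training samples.
   Context: $\mathrm{pred}(f)$ is the smallest index maximizing $f_c$. For $q\in\Delta_k$: $\ell(f,q)=\sum_c q_cL(\mathrm{pred}(f),c)$, $\phi(f,q)=\sum_c q_c\Phi(f,c)$, $\delta\ell(f,q)=\ell(f,q)-\inf_{\hat f\in\mathcal{F}}\ell(\hat f,q)$, $\delta\phi(f,q)=\phi(f,q)-\inf_{\hat f\in\mathcal{F}}\phi(\hat f,q)$. Calibration function: $H_{\Phi,L,\mathcal{F}}(\varepsilon)=\inf\{\delta\phi(f,q):f\in\mathcal{F},q\in\Delta_k,\delta\ell(f,q)\ge\varepsilon\}$ ($+\infty$ if empty). $\mathcal{F}_{\mathcal{F}}$ is the set of Borel measurable functions $\mathcal{X}\to\mathcal{F}$; $\mathcal{R}_L(f)=\mathbb{E}_{\mathcal{D}}L(\mathrm{pred}(f(x)),y)$,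 $\mathcal{R}_\Phi(f)=\mathbb{E}_{\mathcal{D}}\Phi(f(x),y)$, $\mathcal{R}^*_{L,\mathcal{F}}=\inf_{f\in\mathcal{F}_{\mathcal{F}}}\mathcal{R}_L(f)$. The Hilbert–Schmidt norm of $A$ is $\sqrt{\mathrm{tr}(A^*A)}$.
   Formalization: The lower bound Ȟ is assumed positive at ε (at 0, N* is undefined; for a negative constant Ȟ the claim fails); D and M are taken positive, and the feature map, kernel and subgradient choice are assumed measurable so that the expectations make sense. *)

theory Defs
  imports "HOL-Probability.Probability"
begin

text \<open>Labels are the elements of a finite linearly ordered type 'k (playing the role of
  Y = {1,...,k}); score vectors are elements of real^'k.
  pred f is the smallest index maximizing f.\<close>

definition pred :: "real^'k::{finite,linorder} \<Rightarrow> 'k::{finite,linorder}" where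
  "pred f = (LEAST c. \<forall>c'. f $ c' \<le> f $ c)"

definition prob_simplex :: "(real^'k::finite) set" where
  "prob_simplex = {q. (\<forall>c. 0 \<le> q $ c) \<and> (\<Sum>c\<in>UNIV. q $ c) = 1}"

definition cond_task_loss :: "('k::{finite,linorder} \<Rightarrow> 'k::{finite,linorder} \<Rightarrow> real) \<Rightarrow> real^'k::{finite,linorder} \<Rightarrow> real^'k::{finite,linorder} \<Rightarrow> real" where
  "cond_task_loss L f q = (\<Sum>c\<in>UNIV. q $ c * L (pred f) c)"

definition cond_surr_loss :: "(real^'k::finite \<Rightarrow> 'k::finite \<Rightarrow> real) \<Rightarrow> real^'k::finite \<Rightarrow> real^'k::finite \<Rightarrow> real" where
  "cond_surr_loss Phi f q = (\<Sum>c\<in>UNIV. q $ c * Phi f c)"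

definition excess_task_loss ::
  "('k::{finite,linorder} \<Rightarrow> 'k::{finite,linorder} \<Rightarrow> real) \<Rightarrow> (real^'k::{finite,linorder}) set \<Rightarrow> real^'k::{finite,linorder} \<Rightarrow> real^'k::{finite,linorder} \<Rightarrow> real" where
  "excess_task_loss L FS f q = cond_task_loss L f q - (INF f'\<in>FS. cond_task_loss L f' q)"

definition excess_surr_loss ::
  "(real^'k::finite \<Rightarrow> 'k::finite \<Rightarrow> real) \<Rightarrow> (real^'k::finite) set \<Rightarrow> real^'k::finite \<Rightarrow> real^'k::finite \<Rightarrow> real" where
  "excess_surr_loss Phi FS f q = cond_surr_loss Phi f q - (INF f'\<in>FS. cond_surr_loss Phi f' q)"

text \<open>Calibration function H_{Phi,L,F}(eps); the infimum of the empty set is +\<infinity> in ereal.\<close>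
definition calibration_function ::
  "(real^'k::{finite,linorder} \<Rightarrow> 'k::{finite,linorder} \<Rightarrow> real) \<Rightarrow> ('k::{finite,linorder} \<Rightarrow> 'k::{finite,linorder} \<Rightarrow> real) \<Rightarrow> (real^'k::{finite,linorder}) set \<Rightarrow> real \<Rightarrow> ereal" where
  "calibration_function Phi L FS eps =
     (INF fq\<in>{(f, q). f \<in> FS \<and> q \<in> prob_simplex \<and> excess_task_loss L FS f q \<ge> eps}.
        ereal (excess_surr_loss Phi FS (fst fq) (snd fq)))"

text \<open>D is a probability measure on X \<times> Y whose sigma-algebra is the product of the
  sigma-algebra MX on X and the discrete one on Y.\<close>

definition measurable_scores :: "'x measure \<Rightarrow> (real^'k::finite) set \<Rightarrow> ('x \<Rightarrow> real^'k::finite) set" where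
  "measurable_scores MX FS = {f. f \<in> borel_measurable MX \<and> (\<forall>x\<in>space MX. f x \<in> FS)}"

definition risk_L :: "('k::{finite,linorder} \<Rightarrow> 'k::{finite,linorder} \<Rightarrow> real) \<Rightarrow> ('x \<times> 'k::{finite,linorder}) measure \<Rightarrow> ('x \<Rightarrow> real^'k::{finite,linorder}) \<Rightarrow> real" where
  "risk_L L D f = (\<integral>z. L (pred (f (fst z))) (snd z) \<partial>D)"

text \<open>Surrogate risk as an extended real (the surrogate is bounded below, so this is the
  usual expectation, possibly +\<infinity>).\<close>
definition risk_Phi :: "(real^'k::finite \<Rightarrow> 'k::finite \<Rightarrow> real) \<Rightarrow> ('x \<times> 'k::finite) measure \<Rightarrow> ('x \<Rightarrow> real^'k::finite) \<Rightarrow> ereal" where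
  "risk_Phi Phi D f =
     enn2ereal (\<integral>\<^sup>+z. ennreal (max 0 (Phi (f (fst z)) (snd z))) \<partial>D)
   - enn2ereal (\<integral>\<^sup>+z. ennreal (max 0 (- Phi (f (fst z)) (snd z))) \<partial>D)"

definition opt_risk_L :: "('k::{finite,linorder} \<Rightarrow> 'k::{finite,linorder} \<Rightarrow> real) \<Rightarrow> 'x measure \<Rightarrow> ('x \<times> 'k::{finite,linorder}) measure \<Rightarrow> (real^'k::{finite,linorder}) set \<Rightarrow> real" where
  "opt_risk_L L MX D FS = (INF f\<in>measurable_scores MX FS. risk_L L D f)"

definition opt_risk_Phi :: "(real^'k::finite \<Rightarrow> 'k::finite \<Rightarrow> real) \<Rightarrow> 'x measure \<Rightarrow> ('x \<times> 'k::finite) measure \<Rightarrow> (real^'k::finite) set \<Rightarrow> ereal" where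
  "opt_risk_Phi Phi MX D FS = (INF f\<in>measurable_scores MX FS. risk_Phi Phi D f)"

definition orthonormal_finite_sets :: "'h::real_inner set set" where
  "orthonormal_finite_sets = {B. finite B \<and> (\<forall>b\<in>B. norm b = 1) \<and> (\<forall>b\<in>B. \<forall>b'\<in>B. b \<noteq> b' \<longrightarrow> b \<bullet> b' = 0)}"

text \<open>tr(W* W) = sum over an orthonormal basis (e_i) of |W e_i|^2 = supremum of these sums
  over finite orthonormal families.\<close>
definition hs_sq_sums :: "('h::real_inner \<Rightarrow> 'b::real_normed_vector) \<Rightarrow> real set" where
  "hs_sq_sums W = (\<lambda>B. \<Sum>b\<in>B. (norm (W b))\<^sup>2) ` orthonormal_finite_sets"

definition hs_finite :: "('h::real_inner \<Rightarrow> 'b::real_normed_vector) \<Rightarrow> bool" where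
  "hs_finite W \<longleftrightarrow> bdd_above (hs_sq_sums W)"

definition hs_norm :: "('h::real_inner \<Rightarrow> 'b::real_normed_vector) \<Rightarrow> real" where
  "hs_norm W = sqrt (Sup (hs_sq_sums W))"

definition proj_hs :: "real \<Rightarrow> ('h::real_inner \<Rightarrow> 'b::real_normed_vector) \<Rightarrow> ('h \<Rightarrow> 'b)" where
  "proj_hs R W = (if hs_norm W \<le> R then W else (\<lambda>h. (R / hs_norm W) *\<^sub>R W h))"

definition rank_one :: "'b::real_vector \<Rightarrow> 'h::real_inner \<Rightarrow> ('h \<Rightarrow> 'b)" where
  "rank_one v p = (\<lambda>h. (p \<bullet> h) *\<^sub>R v)"

text \<open>s t is the t-th sample (t = 1..N); g f y is the (sub)gradient oracle of Phi(.,y) at f.\<close>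
primrec asgd_iter ::
  "real^'r^'k::finite \<Rightarrow> ('x \<Rightarrow> 'h::real_inner) \<Rightarrow> (real^'k::finite \<Rightarrow> 'k::finite \<Rightarrow> real^'k::finite) \<Rightarrow> real \<Rightarrow> real
   \<Rightarrow> (nat \<Rightarrow> 'x \<times> 'k::finite) \<Rightarrow> nat \<Rightarrow> ('h \<Rightarrow> real^'r::finite)" where
  "asgd_iter F psi g gamma R s 0 = (\<lambda>h. 0)"
| "asgd_iter F psi g gamma R s (Suc t) =
     (let W = asgd_iter F psi g gamma R s t;
          x = fst (s (Suc t)); y = snd (s (Suc t));
          G = rank_one (transpose F *v g (F *v W (psi x)) y) (psi x)
      in proj_hs R (\<lambda>h. W h - gamma *\<^sub>R G h))"

definition asgd_avg ::
  "real^'r^'k::finite \<Rightarrow> ('x \<Rightarrow> 'h::real_inner) \<Rightarrow> (real^'k::finite \<Rightarrow> 'k::finite \<Rightarrow> real^'k::finite) \<Rightarrow> real \<Rightarrow> real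
   \<Rightarrow> nat \<Rightarrow> (nat \<Rightarrow> 'x \<times> 'k::finite) \<Rightarrow> ('h \<Rightarrow> real^'r::finite)" where
  "asgd_avg F psi g gamma R N s = (\<lambda>h. (1 / real N) *\<^sub>R (\<Sum>t\<in>{1..N}. asgd_iter F psi g gamma R s t h))"

end

(*
  A Hilbert--Schmidt operator into R^r is the vector w of its r representing elements of H, so
  ASGD is projected stochastic subgradient descent in the Hilbert space H^r.  Each step decreases
  the squared distance to the optimal operator V by at least
  2 gamma (Phi(f_W) - Phi(f_V)) - gamma^2 |G|^2, where G is the stochastic gradient at W.  After
  W^(1), at squared distance at most 4 D^2 from V, there are N - 1 further steps; adding a virtual
  step from W^(N) with a fresh sample and telescoping over t = 1..N bounds the expected surrogate
  excess of the average by 2 D M / sqrt N, which is less than H(eps).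

  For the task risk, take a supporting line of slope a >= 0 of H at eps.  Applied pointwise to the
  conditional label distributions q(x), the calibration bound becomes linear,
  H(eps) + a (dl(f,q) - eps) <= dphi(f,q), and can be integrated over x and over the training
  samples.  Measurable near-minimisers of phi(., q(x)), picked from a countable dense subset of
  the score space, show that the pointwise infima integrate to the optimal surrogate risk.
*)

theory Submission
  imports Defs
begin

section \<open>Hilbert--Schmidt operators into a Euclidean space\<close>

text \<open>The average runs over W^(1), ..., W^(N) rather than W^(0), ..., W^(N-1). The telescoped
  sum therefore starts at W^(1), of which only membership in the ball is known, and the squared
  distance D^2 available at W^(0) = 0 is replaced by the squared diameter 4 D^2. The step size
  equalises the two terms that remain after division by N, 4 D^2 / (2 gamma N) and gamma M^2 / 2:
  each is D M / sqrt N, which explains the threshold 4 D^2 M^2 / H(eps)^2.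

  The lower bound of the calibration function need not be strictly increasing, so it cannot simply
  be inverted at the surrogate excess. The supporting line at eps avoids inversion and also replaces
  Jensen's inequality, once over x and once over the samples. Its slope may be 0; no division by it
  occurs, and the strictness of the conclusion comes from the strict inequality between the
  convergence rate and H(eps).\<close>

lemma orthonormal_inner_sum:
  assumes "B \<in> orthonormal_finite_sets" "b \<in> B"
  shows "(\<Sum>c\<in>B. u c *\<^sub>R c) \<bullet> b = u b"
proof -
  have "(\<Sum>c\<in>B. u c *\<^sub>R c) \<bullet> b = (\<Sum>c\<in>B. if c = b then u b else 0)"
    unfolding inner_sum_left using assms
    by (intro sum.cong) (auto simp: orthonormal_finite_sets_def dot_square_norm)
  then show ?thesis
    using assms by (auto simp: orthonormal_finite_sets_def)
qed

lemma orthonormal_expansion: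
  assumes B: "B \<in> orthonormal_finite_sets" and x: "x \<in> span B"
  shows "x = (\<Sum>b\<in>B. (x \<bullet> b) *\<^sub>R b)"
proof -
  have "finite B" using B by (simp add: orthonormal_finite_sets_def)
  then obtain u where u: "x = (\<Sum>b\<in>B. u b *\<^sub>R b)"
    using x by (auto simp: span_finite)
  then have "x \<bullet> b = u b" if "b \<in> B" for b
    using orthonormal_inner_sum[OF B that, of u] by simp
  then show ?thesis using u by simp
qed

lemma orthonormal_parseval:
  assumes B: "B \<in> orthonormal_finite_sets" and x: "x \<in> span B"
  shows "(\<Sum>b\<in>B. (x \<bullet> b)\<^sup>2) = (norm x)\<^sup>2"
proof -
  have "x \<bullet> x = x \<bullet> (\<Sum>b\<in>B. (x \<bullet> b) *\<^sub>R b)"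
    using orthonormal_expansion[OF B x] by simp
  also have "\<dots> = (\<Sum>b\<in>B. (x \<bullet> b)\<^sup>2)"
    by (simp only: inner_sum_right inner_scaleR_right power2_eq_square)
  finally show ?thesis by (simp add: power2_norm_eq_inner)
qed

text \<open>The orthogonal projection \<open>p\<close> of \<open>x\<close> satisfies
  \<open>x \<bullet> p = p \<bullet> p\<close>, both being the sum on the left, so the claim is that
  \<open>x - p\<close> has nonnegative square.\<close>

lemma orthonormal_bessel:
  assumes B: "B \<in> orthonormal_finite_sets"
  shows "(\<Sum>b\<in>B. (x \<bullet> b)\<^sup>2) \<le> (norm x)\<^sup>2"
proof -
  define p where "p = (\<Sum>b\<in>B. (x \<bullet> b) *\<^sub>R b)"
  have "x \<bullet> p = (\<Sum>b\<in>B. (x \<bullet> b)\<^sup>2)"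
    by (simp add: p_def inner_sum_right power2_eq_square)
  moreover have "p \<bullet> p = (\<Sum>b\<in>B. (x \<bullet> b)\<^sup>2)"
    using orthonormal_inner_sum[OF B, of _ "\<lambda>b. x \<bullet> b"]
    by (simp add: p_def inner_sum_right power2_eq_square)
  moreover have "0 \<le> (x - p) \<bullet> (x - p)" by simp
  ultimately show ?thesis
    by (simp add: inner_diff inner_commute power2_norm_eq_inner)
qed

text \<open>Gram--Schmidt, adjoining the normalised residual of each new vector. Applied to the
  finitely many components of a \<open>w\<close>, it gives a finite family on which Bessel's
  inequality is an equality, so no orthonormal basis of the whole space is needed.\<close>

lemma orthonormal_span_superset:
  fixes S :: "'h::real_inner set"
  assumes "finite S"
  obtains B where "B \<in> orthonormal_finite_sets" "S \<subseteq> span B"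
proof -
  from assms have "\<exists>B\<in>orthonormal_finite_sets. S \<subseteq> span B"
  proof (induction S)
    case empty
    show ?case by (intro bexI[of _ "{}"]) (auto simp: orthonormal_finite_sets_def)
  next
    case (insert x S)
    then obtain B where B: "B \<in> orthonormal_finite_sets" "S \<subseteq> span B" by blast
    define p where "p = (\<Sum>b\<in>B. (x \<bullet> b) *\<^sub>R b)"
    have p: "p \<in> span B"
      unfolding p_def by (intro span_sum span_scale span_base)
    show ?case
    proof (cases "x = p")
      case True
      then show ?thesis using B p by auto
    next
      case False
      define e where "e = (x - p) /\<^sub>R norm (x - p)"
      have "e \<bullet> b = 0" if "b \<in> B" for b
        using orthonormal_inner_sum[OF B(1) that, of "\<lambda>b. x \<bullet> b"]
        by (simp add: e_def p_def inner_diff_left)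
      then have on: "insert e B \<in> orthonormal_finite_sets"
        using B(1) False by (auto simp: orthonormal_finite_sets_def e_def inner_commute)
      have le: "span B \<subseteq> span (insert e B)"
        by (intro span_mono) auto
      have "x = p + norm (x - p) *\<^sub>R e"
        using False by (simp add: e_def)
      also have "\<dots> \<in> span (insert e B)"
        using p le by (intro span_add span_scale) (auto intro: span_base)
      finally show ?thesis using on le B(2) by blast
    qed
  qed
  then show thesis using that by blast
qed

section \<open>Operators as vectors of representing elements\<close>

definition hs_op :: "'h::real_inner^'r::finite \<Rightarrow> 'h \<Rightarrow> real^'r" where
  "hs_op w h = (\<chi> j. w $ j \<bullet> h)"

definition tensor :: "real^'r::finite \<Rightarrow> 'h::real_inner \<Rightarrow> 'h^'r" where
  "tensor v p = (\<chi> j. v $ j *\<^sub>R p)"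

text \<open>This is the Hilbert--Schmidt inner product of \<open>W\<close> with
  \<open>hs_op w\<close>; for \<open>W = hs_op v\<close> it is \<open>v \<bullet> w\<close>. It only
  evaluates \<open>W\<close>, so it makes sense without representing elements of
  \<open>W\<close>.\<close>

definition hs_pairing :: "('h::real_inner \<Rightarrow> real^'r::finite) \<Rightarrow> 'h^'r \<Rightarrow> real" where
  "hs_pairing W w = (\<Sum>j\<in>UNIV. W (w $ j) $ j)"

lemma norm_vec_sq: "(norm w)\<^sup>2 = (\<Sum>j\<in>UNIV. (norm (w $ j))\<^sup>2)"
  for w :: "'h::real_inner^'r::finite"
  by (simp add: power2_norm_eq_inner inner_vec_def)

lemma hs_op_simps:
  "hs_op 0 h = 0" "hs_op (c *\<^sub>R w) h = c *\<^sub>R hs_op w h"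
  "hs_op (w - w') h = hs_op w h - hs_op w' h"
  by (simp_all add: hs_op_def vec_eq_iff inner_diff_left)

lemma hs_op_sum: "hs_op (\<Sum>i\<in>I. w i) h = (\<Sum>i\<in>I. hs_op (w i) h)"
  by (simp add: hs_op_def vec_eq_iff inner_sum_left)

lemma hs_op_tensor: "hs_op (tensor v p) h = (p \<bullet> h) *\<^sub>R v"
  by (simp add: hs_op_def tensor_def vec_eq_iff)

lemma rank_one_eq_hs_op: "rank_one v p = hs_op (tensor v p)"
  by (simp add: rank_one_def hs_op_tensor fun_eq_iff)

lemma inner_tensor: "w \<bullet> tensor v p = v \<bullet> hs_op w p"
  by (simp add: tensor_def hs_op_def inner_vec_def)

lemma norm_tensor: "norm (tensor v p) = norm v * norm p"
proof -
  have "(norm (tensor v p))\<^sup>2 = (norm v * norm p)\<^sup>2"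
    unfolding power2_norm_eq_inner inner_tensor hs_op_tensor power_mult_distrib by simp
  then show ?thesis by simp
qed

lemma linear_hs_op: "linear (hs_op w)"
  by (intro linearI) (simp_all add: hs_op_def vec_eq_iff inner_add_right)

lemma hs_sum_sq:
  assumes "B \<in> orthonormal_finite_sets"
  shows "(\<Sum>b\<in>B. (norm (hs_op w b))\<^sup>2) = (\<Sum>j\<in>UNIV. \<Sum>b\<in>B. (w $ j \<bullet> b)\<^sup>2)"
  unfolding norm_vec_sq by (subst sum.swap) (simp add: hs_op_def)

lemma hs_op_sums_le:
  assumes "B \<in> orthonormal_finite_sets"
  shows "(\<Sum>b\<in>B. (norm (hs_op w b))\<^sup>2) \<le> (norm w)\<^sup>2"
  unfolding hs_sum_sq[OF assms] norm_vec_sq[of w]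
  by (intro sum_mono orthonormal_bessel[OF assms])

lemma hs_finite_hs_op: "hs_finite (hs_op w)"
  unfolding hs_finite_def hs_sq_sums_def
  by (intro bdd_aboveI[of _ "(norm w)\<^sup>2"]) (auto intro: hs_op_sums_le)

text \<open>Bessel caps every sum in the supremum by \<open>(norm w)\<^sup>2\<close>, and a family
  whose span contains all components of \<open>w\<close> attains the cap by Parseval. Hence the
  Hilbert--Schmidt projection becomes the ordinary ball projection in \<open>'h^'r\<close>.\<close>

lemma hs_norm_hs_op: "hs_norm (hs_op w) = norm w"
proof -
  have "finite (range (\<lambda>j. w $ j))" by simp
  then obtain B where B: "B \<in> orthonormal_finite_sets" "range (\<lambda>j. w $ j) \<subseteq> span B"
    using orthonormal_span_superset by metis
  have "(\<Sum>b\<in>B. (norm (hs_op w b))\<^sup>2) = (norm w)\<^sup>2"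
    unfolding hs_sum_sq[OF B(1)] norm_vec_sq[of w]
    using B(2) by (intro sum.cong refl orthonormal_parseval[OF B(1)]) auto
  then have "Sup (hs_sq_sums (hs_op w)) = (norm w)\<^sup>2"
    unfolding hs_sq_sums_def
    by (intro cSup_eq_maximum) (use B(1) in \<open>force intro: hs_op_sums_le\<close>)+
  then show ?thesis by (simp add: hs_norm_def)
qed

lemma hs_norm_sums_le:
  assumes "hs_finite W" "B \<in> orthonormal_finite_sets"
  shows "(\<Sum>b\<in>B. (norm (W b))\<^sup>2) \<le> (hs_norm W)\<^sup>2"
proof -
  have *: "(\<Sum>b\<in>B. (norm (W b))\<^sup>2) \<le> Sup (hs_sq_sums W)"
    using assms unfolding hs_finite_def hs_sq_sums_def by (intro cSup_upper) auto
  moreover have "0 \<le> (\<Sum>b\<in>B. (norm (W b))\<^sup>2)" by (intro sum_nonneg) auto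
  ultimately show ?thesis by (simp add: hs_norm_def)
qed

lemma hs_norm_nonneg:
  assumes "hs_finite W" shows "0 \<le> hs_norm W"
proof -
  have "0 \<in> hs_sq_sums W"
    unfolding hs_sq_sums_def by (intro image_eqI[of _ _ "{}"]) (auto simp: orthonormal_finite_sets_def)
  then have "0 \<le> Sup (hs_sq_sums W)"
    using assms unfolding hs_finite_def by (intro cSup_upper)
  then show ?thesis by (simp add: hs_norm_def)
qed

text \<open>A normalised vector alone is an orthonormal family, so the operator norm is at most
  \<open>hs_norm W\<close>. The continuity obtained makes \<open>Wstar\<close> composed with the
  feature map measurable.\<close>

lemma hs_bounded_linear:
  assumes "linear W" "hs_finite W"
  shows "bounded_linear W"
proof (intro bounded_linear_intro)
  fix h
  show "norm (W h) \<le> norm h * hs_norm W"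
  proof (cases "h = 0")
    case True
    then show ?thesis using linear_0[OF assms(1)] by simp
  next
    case False
    have "(\<Sum>b\<in>{h /\<^sub>R norm h}. (norm (W b))\<^sup>2) \<le> (hs_norm W)\<^sup>2"
      using False by (intro hs_norm_sums_le[OF assms(2)]) (auto simp: orthonormal_finite_sets_def)
    then have "norm (W (h /\<^sub>R norm h)) \<le> hs_norm W"
      using hs_norm_nonneg[OF assms(2)] by simp
    then show ?thesis
      using False by (simp add: linear_cmul[OF assms(1)] field_simps)
  qed
qed (simp_all add: linear_add[OF assms(1)] linear_cmul[OF assms(1)])

lemma hs_pairing_simps:
  assumes "linear W"
  shows "hs_pairing W (c *\<^sub>R w) = c * hs_pairing W w"
    "hs_pairing W (w - w') = hs_pairing W w - hs_pairing W w'"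
  using linear_cmul[OF assms] linear_diff[OF assms]
  by (simp_all add: hs_pairing_def sum_distrib_left sum_subtractf)

lemma hs_pairing_tensor:
  assumes "linear W"
  shows "hs_pairing W (tensor v p) = v \<bullet> W p"
  using linear_cmul[OF assms] by (simp add: hs_pairing_def tensor_def inner_vec_def)

text \<open>Cauchy--Schwarz for the Hilbert--Schmidt inner product. Expanding the components of
  \<open>w\<close> in a finite orthonormal family turns the pairing into a sum of
  \<open>hs_op w b \<bullet> W b\<close>, to which the finite-dimensional inequality
  applies.\<close>

lemma hs_pairing_le:
  fixes W :: "'h::real_inner \<Rightarrow> real^'r::finite"
  assumes W: "linear W" "hs_finite W"
  shows "hs_pairing W w \<le> hs_norm W * norm w"
proof -
  have "finite (range (\<lambda>j. w $ j))" by simp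
  then obtain B where B: "B \<in> orthonormal_finite_sets" "range (\<lambda>j. w $ j) \<subseteq> span B"
    using orthonormal_span_superset by metis
  have "hs_pairing W w = (\<Sum>j\<in>UNIV. \<Sum>b\<in>B. (w $ j \<bullet> b) * W b $ j)"
    unfolding hs_pairing_def
  proof (intro sum.cong refl)
    fix j
    have "W (w $ j) = W (\<Sum>b\<in>B. (w $ j \<bullet> b) *\<^sub>R b)"
      using orthonormal_expansion[OF B(1)] B(2) by (metis rangeI subsetD)
    then show "W (w $ j) $ j = (\<Sum>b\<in>B. (w $ j \<bullet> b) * W b $ j)"
      by (simp add: linear_sum[OF W(1)] linear_cmul[OF W(1)])
  qed
  also have "\<dots> = (\<Sum>b\<in>B. hs_op w b \<bullet> W b)"
    by (subst sum.swap) (simp add: hs_op_def inner_vec_def)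
  also have "\<dots> \<le> (\<Sum>b\<in>B. \<bar>norm (hs_op w b)\<bar> * \<bar>norm (W b)\<bar>)"
    by (intro sum_mono) (simp add: norm_cauchy_schwarz)
  also have "\<dots> \<le> L2_set (\<lambda>b. norm (hs_op w b)) B * L2_set (\<lambda>b. norm (W b)) B"
    by (rule L2_set_mult_ineq)
  also have "\<dots> \<le> norm w * hs_norm W"
    unfolding L2_set_def using hs_op_sums_le[OF B(1)] hs_norm_sums_le[OF W(2) B(1)]
    by (intro mult_mono) (auto intro!: real_le_lsqrt sum_nonneg hs_norm_nonneg[OF W(2)])
  finally show ?thesis by (simp add: mult.commute)
qed

section \<open>Ball projection and the potential of a comparison operator\<close>

definition ball_proj :: "real \<Rightarrow> 'a::real_normed_vector \<Rightarrow> 'a" where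
  "ball_proj R u = (if norm u \<le> R then u else (R / norm u) *\<^sub>R u)"

lemma norm_ball_proj: "0 \<le> R \<Longrightarrow> norm (ball_proj R u) \<le> R"
  by (auto simp: ball_proj_def)

lemma proj_hs_hs_op: "proj_hs R (hs_op w) = hs_op (ball_proj R w)"
  by (simp add: proj_hs_def ball_proj_def hs_norm_hs_op hs_op_simps fun_eq_iff)

text \<open>The potential is the squared Hilbert--Schmidt distance from \<open>w\<close> to \<open>W\<close>, up to the
  replacement of \<open>hs_norm W\<close> by its bound \<open>R\<close>; expressing it through the pairing
  avoids representing \<open>W\<close> as a vector.\<close>

definition potential :: "real \<Rightarrow> ('h::real_inner \<Rightarrow> real^'r::finite) \<Rightarrow> 'h^'r \<Rightarrow> real" where
  "potential R W w = (norm w)\<^sup>2 - 2 * hs_pairing W w + R\<^sup>2"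

context
  fixes W :: "'h::real_inner \<Rightarrow> real^'r::finite" and R :: real
  assumes W: "linear W" "hs_finite W" "hs_norm W \<le> R"
begin

lemma hs_pairing_le_radius: "hs_pairing W w \<le> R * norm w"
  using hs_pairing_le[OF W(1,2), of w] mult_right_mono[OF W(3), of "norm w"] by simp

text \<open>By Cauchy--Schwarz the potential is at least \<open>(norm w - R)\<^sup>2\<close>, so it
  stays nonnegative although \<open>R\<close> stands in for the norm of \<open>W\<close>.\<close>

lemma potential_nonneg: "0 \<le> potential R W w"
proof -
  have "0 \<le> (norm w - R)\<^sup>2" by simp
  then show ?thesis
    using hs_pairing_le_radius[of w] by (simp add: potential_def power2_diff mult.commute mult.left_commute)
qed

lemma potential_le:
  assumes "norm w \<le> R"
  shows "potential R W w \<le> 4 * R\<^sup>2"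
proof -
  have "- hs_pairing W w \<le> R * norm w"
    using hs_pairing_le_radius[of "- w"] hs_pairing_simps(1)[OF W(1), of "-1" w] by simp
  moreover have "R * norm w \<le> R\<^sup>2" "(norm w)\<^sup>2 \<le> R\<^sup>2"
    using assms norm_ge_zero[of w] order_trans[OF norm_ge_zero assms]
    by (auto simp: power2_eq_square intro!: mult_left_mono mult_mono)
  ultimately show ?thesis by (simp add: potential_def)
qed

text \<open>Projecting onto a ball that contains \<open>W\<close> does not move away from
  \<open>W\<close>. With \<open>n\<close> the norm of \<open>u\<close> and \<open>a\<close> the
  component of \<open>W\<close> along the direction of \<open>u\<close>, the decrease is
  \<open>(n - R) * (n + R - 2 * a)\<close>, where \<open>a \<le> R < n\<close>.\<close>

lemma potential_ball_proj: "potential R W (ball_proj R u) \<le> potential R W u"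
proof (cases "norm u \<le> R")
  case False
  have R: "0 \<le> R" using hs_norm_nonneg[OF W(2)] W(3) by simp
  define n where "n = norm u"
  have n: "n > R" "n > 0" using False R by (auto simp: n_def)
  define a where "a = hs_pairing W u / n"
  have a: "a \<le> R" and pa: "hs_pairing W u = a * n"
    using hs_pairing_le_radius[of u] n by (auto simp: a_def n_def field_simps)
  have "potential R W u - potential R W (ball_proj R u) = n\<^sup>2 - 2 * a * n - R\<^sup>2 + 2 * R * a"
    using False n by (simp add: ball_proj_def potential_def hs_pairing_simps[OF W(1)] pa
        flip: n_def)
  also have "\<dots> = (n - R) * (n + R - 2 * a)"
    by (simp add: algebra_simps power2_eq_square)
  also have "\<dots> \<ge> 0" using n a by (intro mult_nonneg_nonneg) auto
  finally show ?thesis by simp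
qed (simp add: ball_proj_def)

text \<open>Before projection this is an equality, obtained by expanding the square: pairing the
  rank-one gradient with an operator evaluates the operator at \<open>p\<close>, which produces the
  cross term. The projection can only lower the left side.\<close>

lemma potential_gradient_step:
  "potential R W (ball_proj R (w - c *\<^sub>R tensor v p))
     \<le> potential R W w - 2 * c * (v \<bullet> (hs_op w p - W p)) + c\<^sup>2 * (norm (tensor v p))\<^sup>2"
proof -
  have "(norm (w - c *\<^sub>R tensor v p))\<^sup>2
      = (norm w)\<^sup>2 - 2 * c * (v \<bullet> hs_op w p) + c\<^sup>2 * (norm (tensor v p))\<^sup>2"
    unfolding power2_norm_eq_inner
    by (simp add: inner_diff inner_commute[of "tensor v p" w] inner_tensor[of w]
        algebra_simps power2_eq_square)
  then have "potential R W (w - c *\<^sub>R tensor v p)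
      = potential R W w - 2 * c * (v \<bullet> (hs_op w p - W p)) + c\<^sup>2 * (norm (tensor v p))\<^sup>2"
    by (simp add: potential_def hs_pairing_simps[OF W(1)] hs_pairing_tensor[OF W(1)] algebra_simps)
  then show ?thesis using potential_ball_proj[of "w - c *\<^sub>R tensor v p"] by simp
qed

end

section \<open>Projected stochastic subgradient descent\<close>

definition sgd_grad ::
  "real^'r::finite^'k::finite \<Rightarrow> ('x \<Rightarrow> 'h::real_inner) \<Rightarrow> (real^'k \<Rightarrow> 'k \<Rightarrow> real^'k)
   \<Rightarrow> 'h^'r \<Rightarrow> 'x \<times> 'k \<Rightarrow> real^'r" where
  "sgd_grad F psi g w z = transpose F *v g (F *v hs_op w (psi (fst z))) (snd z)"

definition sgd_step ::
  "real^'r::finite^'k::finite \<Rightarrow> ('x \<Rightarrow> 'h::real_inner) \<Rightarrow> (real^'k \<Rightarrow> 'k \<Rightarrow> real^'k) \<Rightarrow> real \<Rightarrow> real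
   \<Rightarrow> 'h^'r \<Rightarrow> 'x \<times> 'k \<Rightarrow> 'h^'r" where
  "sgd_step F psi g c R w z = ball_proj R (w - c *\<^sub>R tensor (sgd_grad F psi g w z) (psi (fst z)))"

primrec sgd_iter ::
  "real^'r::finite^'k::finite \<Rightarrow> ('x \<Rightarrow> 'h::real_inner) \<Rightarrow> (real^'k \<Rightarrow> 'k \<Rightarrow> real^'k) \<Rightarrow> real \<Rightarrow> real
   \<Rightarrow> (nat \<Rightarrow> 'x \<times> 'k) \<Rightarrow> nat \<Rightarrow> 'h^'r" where
  "sgd_iter F psi g c R s 0 = 0"
| "sgd_iter F psi g c R s (Suc t) = sgd_step F psi g c R (sgd_iter F psi g c R s t) (s (Suc t))"

lemma asgd_iter_eq: "asgd_iter F psi g c R s t = hs_op (sgd_iter F psi g c R s t)"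
proof (induction t)
  case 0
  then show ?case by (simp add: fun_eq_iff hs_op_simps)
next
  case (Suc t)
  show ?case
    by (simp add: Suc Let_def rank_one_eq_hs_op sgd_step_def sgd_grad_def flip: hs_op_simps proj_hs_hs_op)
qed

lemma asgd_avg_eq:
  "asgd_avg F psi g c R N s = hs_op ((1 / real N) *\<^sub>R (\<Sum>t\<in>{1..N}. sgd_iter F psi g c R s t))"
  by (simp add: asgd_avg_def asgd_iter_eq fun_eq_iff hs_op_simps hs_op_sum)

lemma norm_sgd_iter: "0 \<le> R \<Longrightarrow> norm (sgd_iter F psi g c R s t) \<le> R"
  by (cases t) (auto simp: sgd_step_def norm_ball_proj)

lemma norm_sgd_avg:
  assumes "0 \<le> R"
  shows "norm ((1 / real N) *\<^sub>R (\<Sum>t\<in>{1..N}. sgd_iter F psi g c R s t)) \<le> R"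
proof (cases "N = 0")
  case False
  have "norm (\<Sum>t\<in>{1..N}. sgd_iter F psi g c R s t) \<le> (\<Sum>t\<in>{1..N}. R)"
    by (intro sum_norm_le norm_sgd_iter assms)
  then show ?thesis using False by (simp add: field_simps)
qed (use assms in simp)

text \<open>Iterate \<open>t\<close> reads the samples \<open>1..t\<close> only. This is the form in
  which its independence of sample \<open>Suc t\<close> is used.\<close>

lemma sgd_iter_cong:
  "(\<And>i. i \<in> {1..t} \<Longrightarrow> s i = s' i) \<Longrightarrow> sgd_iter F psi g c R s t = sgd_iter F psi g c R s' t"
  by (induction t) auto

text \<open>A sample that the first argument of \<open>u\<close> ignores may be replaced by a fresh
  independent one. This plays the part of conditioning on the earlier samples; it is Fubini with
  coordinate \<open>i\<close> split off.\<close>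

lemma nn_integral_PiM_resample:
  fixes u :: "('i \<Rightarrow> 'a) \<times> 'a \<Rightarrow> ennreal"
  assumes "prob_space D" and I: "finite I" "i \<in> I"
    and u[measurable]: "u \<in> borel_measurable (PiM I (\<lambda>_. D) \<Otimes>\<^sub>M D)"
    and indep: "\<And>s z' z. u (s(i := z'), z) = u (s, z)"
  shows "(\<integral>\<^sup>+s. u (s, s i) \<partial>PiM I (\<lambda>_. D)) = (\<integral>\<^sup>+s. \<integral>\<^sup>+z. u (s, z) \<partial>D \<partial>PiM I (\<lambda>_. D))"
proof -
  interpret D: prob_space D by fact
  interpret product_sigma_finite "\<lambda>_::'i. D" by unfold_locales
  define J where "J = I - {i}"
  have J: "I = insert i J" "finite J" "i \<notin> J" using I by (auto simp: J_def)
  have [measurable]: "(\<lambda>s. s i) \<in> PiM I (\<lambda>_. D) \<rightarrow>\<^sub>M D"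
    using I by measurable
  have "(\<integral>\<^sup>+s. u (s, s i) \<partial>PiM I (\<lambda>_. D)) = (\<integral>\<^sup>+s. \<integral>\<^sup>+y. u (s(i := y), y) \<partial>D \<partial>PiM J (\<lambda>_. D))"
    unfolding J(1) by (subst product_nn_integral_insert[OF J(2,3)]) (simp_all flip: J(1))
  \<comment> \<open>Coordinate \<open>i\<close> of the first argument is irrelevant, so it can be
    refilled by a dummy variable, whose integral costs nothing because \<open>D\<close> has mass
    1.\<close>
  also have "\<dots> = (\<integral>\<^sup>+s. \<integral>\<^sup>+y'. \<integral>\<^sup>+y. u (s(i := y'), y) \<partial>D \<partial>D \<partial>PiM J (\<lambda>_. D))"
    by (simp add: indep D.emeasure_space_1)
  also have "\<dots> = (\<integral>\<^sup>+s. \<integral>\<^sup>+z. u (s, z) \<partial>D \<partial>PiM I (\<lambda>_. D))"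
    unfolding J(1) by (subst product_nn_integral_insert[OF J(2,3)]) (simp_all flip: J(1))
  finally show ?thesis .
qed

lemma integral_PiM_resample:
  fixes u :: "('i \<Rightarrow> 'a) \<times> 'a \<Rightarrow> real"
  assumes D: "prob_space D" and I: "finite I" "i \<in> I"
    and u[measurable]: "u \<in> borel_measurable (PiM I (\<lambda>_. D) \<Otimes>\<^sub>M D)"
    and indep: "\<And>s z' z. u (s(i := z'), z) = u (s, z)"
    and bounds: "\<And>s z. 0 \<le> u (s, z)" "\<And>s z. u (s, z) \<le> C"
  shows "(\<integral>s. u (s, s i) \<partial>PiM I (\<lambda>_. D)) = (\<integral>s. \<integral>z. u (s, z) \<partial>D \<partial>PiM I (\<lambda>_. D))"
proof -
  interpret D: prob_space D by fact
  have [measurable]: "(\<lambda>s. s i) \<in> PiM I (\<lambda>_. D) \<rightarrow>\<^sub>M D"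
    using I by measurable
  have int: "integrable D (\<lambda>z. u (s, z))" if "s \<in> space (PiM I (\<lambda>_. D))" for s
    using that bounds by (intro D.integrable_const_bound[of _ C]) auto
  have "(\<integral>s. u (s, s i) \<partial>PiM I (\<lambda>_. D)) = enn2real (\<integral>\<^sup>+s. ennreal (u (s, s i)) \<partial>PiM I (\<lambda>_. D))"
    by (intro integral_eq_nn_integral) (auto simp: bounds)
  also have "\<dots> = enn2real (\<integral>\<^sup>+s. \<integral>\<^sup>+z. ennreal (u (s, z)) \<partial>D \<partial>PiM I (\<lambda>_. D))"
    using nn_integral_PiM_resample[OF D I, of "\<lambda>p. ennreal (u p)"] indep by simp
  also have "\<dots> = enn2real (\<integral>\<^sup>+s. ennreal (\<integral>z. u (s, z) \<partial>D) \<partial>PiM I (\<lambda>_. D))"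
    using int bounds by (intro arg_cong[where f = enn2real] nn_integral_cong nn_integral_eq_integral) auto
  also have "\<dots> = (\<integral>s. \<integral>z. u (s, z) \<partial>D \<partial>PiM I (\<lambda>_. D))"
    by (intro integral_eq_nn_integral[symmetric]) (auto simp: bounds)
  finally show ?thesis .
qed

section \<open>Standing assumptions on the data, the loss and the algorithm\<close>

lemma measurable_matrix_vector_mult[measurable (raw)]:
  fixes A :: "real^'n::finite^'m::finite"
  assumes "f \<in> borel_measurable M"
  shows "(\<lambda>x. A *v f x) \<in> borel_measurable M"
  by (rule borel_measurable_continuous_on[OF _ assms])
    (simp add: linear_continuous_on linear_conv_bounded_linear[symmetric] matrix_vector_mul_linear)

lemma measurable_finite_label:
  fixes f :: "'b \<Rightarrow> 'k::finite \<Rightarrow> 'c"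
  assumes f: "\<And>y. (\<lambda>v. f v y) \<in> N \<rightarrow>\<^sub>M K"
    and [measurable]: "v \<in> M \<rightarrow>\<^sub>M N" "y \<in> M \<rightarrow>\<^sub>M count_space UNIV"
  shows "(\<lambda>x. f (v x) (y x)) \<in> M \<rightarrow>\<^sub>M K"
  by (rule measurable_compose_countable[of "\<lambda>c x. f (v x) c"])
    (auto intro: measurable_compose[OF _ f])

locale labelled_distribution = prob_space D
  for D :: "('x \<times> 'k::finite) measure" +
  fixes MX :: "'x measure"
  assumes D_sets[measurable_cong]: "sets D = sets (MX \<Otimes>\<^sub>M count_space UNIV)"
begin

lemma measurable_fst_D[measurable]: "fst \<in> D \<rightarrow>\<^sub>M MX"
  by (subst measurable_cong_sets[OF D_sets refl]) measurable

lemma measurable_snd_D[measurable]: "snd \<in> D \<rightarrow>\<^sub>M count_space UNIV"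
  by (subst measurable_cong_sets[OF D_sets refl]) measurable

end

locale surrogate_loss =
  fixes Phi :: "real^'k::finite \<Rightarrow> 'k \<Rightarrow> real" and B :: real
  assumes Phi_cont: "\<And>y. continuous_on UNIV (\<lambda>f. Phi f y)"
    and Phi_ge: "\<And>f y. - B \<le> Phi f y"
begin

lemma measurable_Phi[measurable (raw)]:
  assumes "v \<in> borel_measurable N" "y \<in> N \<rightarrow>\<^sub>M count_space UNIV"
  shows "(\<lambda>x. Phi (v x) (y x)) \<in> borel_measurable N"
  by (rule measurable_finite_label[OF _ assms])
    (intro borel_measurable_continuous_onI Phi_cont)

end

text \<open>Here \<open>Wstar\<close> is any comparison operator in the ball with integrable
  surrogate loss; optimality enters only in \<open>theorem6\<close>. Joint measurability of the
  kernel is a separate assumption because, without second countability of \<open>'h\<close>, the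
  inner product need not be measurable for the product of the Borel sigma-algebras.\<close>

locale asgd_problem = labelled_distribution D MX + surrogate_loss Phi B
  for D :: "('x \<times> 'k::finite) measure" and MX :: "'x measure"
    and Phi :: "real^'k \<Rightarrow> 'k \<Rightarrow> real" and B :: real +
  fixes F :: "real^'r::finite^'k"
    and psi :: "'x \<Rightarrow> 'h::real_inner"
    and g :: "real^'k \<Rightarrow> 'k \<Rightarrow> real^'k"
    and Wstar :: "'h \<Rightarrow> real^'r"
    and R M c :: real
  assumes psi_meas[measurable]: "psi \<in> borel_measurable MX"
    and kernel_meas: "(\<lambda>(x, x'). psi x \<bullet> psi x') \<in> borel_measurable (MX \<Otimes>\<^sub>M MX)"
    and Phi_convex: "\<And>y. convex_on UNIV (\<lambda>f. Phi f y)"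
    and g_subgrad: "\<And>f f' y. Phi f' y \<ge> Phi f y + g f y \<bullet> (f' - f)"
    and g_meas: "\<And>y. (\<lambda>f. g f y) \<in> borel_measurable borel"
    and R_pos: "0 < R" and c_pos: "0 < c"
    and W: "linear Wstar" "hs_finite Wstar" "hs_norm Wstar \<le> R"
    and Wstar_integrable: "integrable D (\<lambda>z. Phi (F *v Wstar (psi (fst z))) (snd z))"
    and grad_bound: "\<And>w. norm w \<le> R \<Longrightarrow>
        (\<integral>\<^sup>+z. ennreal ((norm (tensor (sgd_grad F psi g w z) (psi (fst z))))\<^sup>2) \<partial>D) \<le> ennreal (M\<^sup>2)"
begin

abbreviation V where "V \<equiv> potential R Wstar"
abbreviation grad where "grad \<equiv> sgd_grad F psi g"
abbreviation step where "step \<equiv> sgd_step F psi g c R"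
abbreviation iter where "iter \<equiv> sgd_iter F psi g c R"
abbreviation score where "score w x \<equiv> F *v hs_op w (psi x)"

definition excess :: "'h^'r \<Rightarrow> real" where
  "excess w = (\<integral>z. Phi (score w (fst z)) (snd z) - Phi (F *v Wstar (psi (fst z))) (snd z) \<partial>D)"

section \<open>Measurability of gradients, iterates and scores\<close>

lemma measurable_g[measurable (raw)]:
  assumes "v \<in> borel_measurable N" "y \<in> N \<rightarrow>\<^sub>M count_space UNIV"
  shows "(\<lambda>x. g (v x) (y x)) \<in> borel_measurable N"
  by (rule measurable_finite_label[OF g_meas assms])

lemma measurable_kernel[measurable (raw)]:
  assumes [measurable]: "f \<in> N \<rightarrow>\<^sub>M MX" "h \<in> N \<rightarrow>\<^sub>M MX"
  shows "(\<lambda>x. psi (f x) \<bullet> psi (h x)) \<in> borel_measurable N"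
  using measurable_compose[OF measurable_Pair[OF assms] kernel_meas] by simp

lemma measurable_Wstar[measurable]: "(\<lambda>x. Wstar (psi x)) \<in> borel_measurable MX"
  by (rule borel_measurable_continuous_on[OF _ psi_meas])
    (intro linear_continuous_on hs_bounded_linear W)

text \<open>As \<open>'h\<close> need not be second countable, sums of measurable \<open>'h\<close>-valued
  functions may fail to be measurable.  Hence only the scalar quantities derived from the
  iterates are shown to be measurable.\<close>

definition weakly_measurable :: "'s measure \<Rightarrow> ('s \<Rightarrow> 'h^'r) \<Rightarrow> bool" where
  "weakly_measurable S w \<longleftrightarrow> (\<lambda>s. norm (w s)) \<in> borel_measurable S
     \<and> (\<lambda>s. hs_pairing Wstar (w s)) \<in> borel_measurable S
     \<and> (\<lambda>p. hs_op (w (fst p)) (psi (snd p))) \<in> borel_measurable (S \<Otimes>\<^sub>M MX)"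

lemma weakly_measurable_const: "weakly_measurable S (\<lambda>_. w)"
proof -
  have [measurable]: "(\<lambda>x. hs_op w (psi x)) \<in> borel_measurable MX"
    by (rule borel_measurable_continuous_on[OF _ psi_meas])
      (auto simp: hs_op_def intro!: continuous_intros)
  show ?thesis unfolding weakly_measurable_def by measurable
qed

lemma weakly_measurable_compose:
  assumes w: "weakly_measurable S w" and [measurable]: "f \<in> S' \<rightarrow>\<^sub>M S"
  shows "weakly_measurable S' (\<lambda>s. w (f s))"
proof -
  have [measurable]: "(\<lambda>s. norm (w s)) \<in> borel_measurable S"
     "(\<lambda>s. hs_pairing Wstar (w s)) \<in> borel_measurable S"
     and m: "(\<lambda>p. hs_op (w (fst p)) (psi (snd p))) \<in> borel_measurable (S \<Otimes>\<^sub>M MX)"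
    using w by (auto simp: weakly_measurable_def)
  have "(\<lambda>p. (f (fst p), snd p)) \<in> S' \<Otimes>\<^sub>M MX \<rightarrow>\<^sub>M S \<Otimes>\<^sub>M MX" by measurable
  from measurable_compose[OF this m] show ?thesis
    unfolding weakly_measurable_def by simp
qed

lemma weakly_measurable_op:
  assumes w: "weakly_measurable S w" and [measurable]: "f \<in> N \<rightarrow>\<^sub>M S" "h \<in> N \<rightarrow>\<^sub>M MX"
  shows "(\<lambda>x. hs_op (w (f x)) (psi (h x))) \<in> borel_measurable N"
proof -
  have m: "(\<lambda>p. hs_op (w (fst p)) (psi (snd p))) \<in> borel_measurable (S \<Otimes>\<^sub>M MX)"
    using w by (auto simp: weakly_measurable_def)
  have "(\<lambda>x. (f x, h x)) \<in> N \<rightarrow>\<^sub>M S \<Otimes>\<^sub>M MX" by measurable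
  from measurable_compose[OF this m] show ?thesis by simp
qed

lemma weakly_measurable_grad:
  assumes w: "weakly_measurable S w" and [measurable]: "z \<in> S \<rightarrow>\<^sub>M D"
  shows "(\<lambda>s. grad (w s) (z s)) \<in> borel_measurable S"
proof -
  have [measurable]: "(\<lambda>s. hs_op (w s) (psi (fst (z s)))) \<in> borel_measurable S"
    by (rule weakly_measurable_op[OF w]) measurable
  show ?thesis unfolding sgd_grad_def by measurable
qed

text \<open>The three scalar observables are closed under a step. The new norm follows by expanding
  a square, the new pairing by linearity, and the new operator values change by a kernel value times
  the gradient \<open>v s\<close>.\<close>

lemma weakly_measurable_step:
  assumes w: "weakly_measurable S w" and z[measurable]: "z \<in> S \<rightarrow>\<^sub>M D"
  shows "weakly_measurable S (\<lambda>s. step (w s) (z s))"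
proof -
  define x where "x s = fst (z s)" for s
  define v where "v s = grad (w s) (z s)" for s
  define u where "u s = w s - c *\<^sub>R tensor (v s) (psi (x s))" for s
  \<comment> \<open>The projection is written as multiplication by a real factor, so that only
    \<open>norm (u s)\<close> has to be measurable, not \<open>u\<close> itself.\<close>
  define a where "a s = (if norm (u s) \<le> R then 1 else R / norm (u s))" for s
  have [measurable]: "x \<in> S \<rightarrow>\<^sub>M MX" unfolding x_def by measurable
  have [measurable]: "v \<in> borel_measurable S"
    unfolding v_def by (rule weakly_measurable_grad[OF w z])
  have [measurable]: "(\<lambda>s. norm (w s)) \<in> borel_measurable S"
     "(\<lambda>s. hs_pairing Wstar (w s)) \<in> borel_measurable S"
    using w by (auto simp: weakly_measurable_def)
  have [measurable]: "(\<lambda>s. hs_op (w s) (psi (x s))) \<in> borel_measurable S"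
    by (rule weakly_measurable_op[OF w]) measurable
  have [measurable]: "(\<lambda>p. hs_op (w (fst p)) (psi (snd p))) \<in> borel_measurable (S \<Otimes>\<^sub>M MX)"
    by (rule weakly_measurable_op[OF w]) measurable
  have [measurable]: "(\<lambda>s. norm (psi (x s))) \<in> borel_measurable S"
    unfolding norm_eq_sqrt_inner by measurable
  have u_norm: "norm (u s) = sqrt ((norm (w s))\<^sup>2 - 2 * c * (v s \<bullet> hs_op (w s) (psi (x s)))
      + c\<^sup>2 * (norm (v s) * norm (psi (x s)))\<^sup>2)" for s
  proof -
    have "(norm (u s))\<^sup>2 = (norm (w s))\<^sup>2 - 2 * c * (v s \<bullet> hs_op (w s) (psi (x s)))
      + c\<^sup>2 * (norm (tensor (v s) (psi (x s))))\<^sup>2"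
      unfolding power2_norm_eq_inner
      by (simp add: u_def inner_diff inner_commute[of "tensor _ _" "w s"] inner_tensor[of "w s"]
          algebra_simps power2_eq_square)
    then show ?thesis by (metis norm_tensor norm_ge_zero real_sqrt_unique)
  qed
  have [measurable]: "(\<lambda>s. norm (u s)) \<in> borel_measurable S"
    unfolding u_norm by measurable
  have [measurable]: "a \<in> borel_measurable S" unfolding a_def by measurable
  have step: "step (w s) (z s) = a s *\<^sub>R u s" for s
    by (simp add: sgd_step_def ball_proj_def a_def u_def v_def x_def)
  have [measurable]: "(\<lambda>s. hs_pairing Wstar (u s)) \<in> borel_measurable S"
    unfolding u_def hs_pairing_simps[OF W(1)] hs_pairing_tensor[OF W(1)] by measurable
  have [measurable]: "(\<lambda>p. hs_op (u (fst p)) (psi (snd p))) \<in> borel_measurable (S \<Otimes>\<^sub>M MX)"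
    unfolding u_def hs_op_simps hs_op_tensor by measurable
  show ?thesis
    unfolding step weakly_measurable_def hs_op_simps hs_pairing_simps[OF W(1)] norm_scaleR
    by measurable
qed

lemma weakly_measurable_iter:
  "t \<le> N \<Longrightarrow> weakly_measurable (PiM {1..N} (\<lambda>_. D)) (\<lambda>s. iter s t)"
proof (induction t)
  case 0
  show ?case by (simp add: weakly_measurable_const)
next
  case (Suc t)
  then have "(\<lambda>s. s (Suc t)) \<in> PiM {1..N} (\<lambda>_. D) \<rightarrow>\<^sub>M D"
    by (intro measurable_component_singleton) auto
  with Suc show ?case by (auto intro: weakly_measurable_step)
qed

lemma measurable_potential:
  assumes "weakly_measurable S w"
  shows "(\<lambda>s. V (w s)) \<in> borel_measurable S"
proof -
  have [measurable]: "(\<lambda>s. norm (w s)) \<in> borel_measurable S"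
     "(\<lambda>s. hs_pairing Wstar (w s)) \<in> borel_measurable S"
    using assms by (auto simp: weakly_measurable_def)
  show ?thesis unfolding potential_def by measurable
qed

lemma measurable_score:
  assumes "weakly_measurable S w"
  shows "(\<lambda>p. score (w (fst p)) (fst (snd p))) \<in> borel_measurable (S \<Otimes>\<^sub>M D)"
proof -
  have [measurable]: "(\<lambda>p. hs_op (w (fst p)) (psi (fst (snd p)))) \<in> borel_measurable (S \<Otimes>\<^sub>M D)"
    by (rule weakly_measurable_op[OF assms]) measurable
  show ?thesis by measurable
qed

lemma measurable_score_const[measurable]: "(\<lambda>x. score w x) \<in> borel_measurable MX"
proof -
  have [measurable]: "(\<lambda>x. hs_op w (psi x)) \<in> borel_measurable MX"
    \<comment> \<open>A fixed \<open>w\<close> is treated as a family over the one-point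
      space.\<close>
    by (rule weakly_measurable_op[OF weakly_measurable_const[of "count_space UNIV"], of "\<lambda>_. ()"]) measurable
  show ?thesis by measurable
qed

lemma measurable_excess:
  assumes w: "weakly_measurable S w"
  shows "(\<lambda>s. excess (w s)) \<in> borel_measurable S"
proof -
  note measurable_score[OF w, measurable]
  show ?thesis
    unfolding excess_def by measurable
qed

section \<open>Expected progress of a single step\<close>

lemma grad_sq_integrable:
  assumes w: "norm w \<le> R"
  shows "integrable D (\<lambda>z. (norm (tensor (grad w z) (psi (fst z))))\<^sup>2)"
    and "(\<integral>z. (norm (tensor (grad w z) (psi (fst z))))\<^sup>2 \<partial>D) \<le> M\<^sup>2"
proof -
  have [measurable]: "grad w \<in> borel_measurable D"
    using weakly_measurable_grad[OF weakly_measurable_const, of "\<lambda>z. z" D w] by simp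
  have [measurable]: "(\<lambda>z. norm (psi (fst z))) \<in> borel_measurable D"
    unfolding norm_eq_sqrt_inner by measurable
  have m[measurable]: "(\<lambda>z. (norm (tensor (grad w z) (psi (fst z))))\<^sup>2) \<in> borel_measurable D"
    unfolding norm_tensor by measurable
  show "integrable D (\<lambda>z. (norm (tensor (grad w z) (psi (fst z))))\<^sup>2)"
    using grad_bound[OF w] by (intro integrableI_bounded) (auto simp: le_less_trans)
  show "(\<integral>z. (norm (tensor (grad w z) (psi (fst z))))\<^sup>2 \<partial>D) \<le> M\<^sup>2"
    using grad_bound[OF w]
    by (subst integral_eq_nn_integral) (auto intro: enn2real_leI)
qed

text \<open>The subgradient inequality at the current score bounds the excess by an inner product;
  moving \<open>F\<close> across it by transposition gives the cross term of
  \<open>potential_gradient_step\<close>, which is then divided by \<open>2 * c\<close>.\<close>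

lemma step_progress:
  "Phi (score w (fst z)) (snd z) - Phi (F *v Wstar (psi (fst z))) (snd z)
    \<le> (V w - V (step w z)) / (2 * c) + c / 2 * (norm (tensor (grad w z) (psi (fst z))))\<^sup>2"
proof -
  define x y where "x = fst z" and "y = snd z"
  have "Phi (score w x) y - Phi (F *v Wstar (psi x)) y
      \<le> g (score w x) y \<bullet> (F *v (hs_op w (psi x) - Wstar (psi x)))"
    using g_subgrad[of "score w x" y "F *v Wstar (psi x)"]
    by (simp add: matrix_vector_mult_diff_distrib inner_diff_right)
  also have "\<dots> = grad w z \<bullet> (hs_op w (psi x) - Wstar (psi x))"
    by (simp add: sgd_grad_def x_def y_def transpose_matrix_vector dot_lmul_matrix)
  also have "\<dots> \<le> (V w - V (step w z)) / (2 * c) + c / 2 * (norm (tensor (grad w z) (psi x)))\<^sup>2"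
    using potential_gradient_step[OF W, of w c "grad w z" "psi x"] c_pos
    by (simp add: sgd_step_def x_def field_simps power2_eq_square)
  finally show ?thesis by (simp add: x_def y_def)
qed

lemma step_potential_bounds: "0 \<le> V (step w z)" "V (step w z) \<le> 4 * R\<^sup>2"
  using potential_nonneg[OF W] potential_le[OF W, of "step w z"] R_pos
  by (simp_all add: sgd_step_def norm_ball_proj)

lemma step_potential_integrable: "integrable D (\<lambda>z. V (step w z))"
proof -
  have "(\<lambda>z. V (step w z)) \<in> borel_measurable D"
    using measurable_potential[OF weakly_measurable_step[OF weakly_measurable_const, of "\<lambda>z. z" D w]]
    by simp
  then show ?thesis
    using step_potential_bounds by (intro integrable_const_bound[of _ "4 * R\<^sup>2"]) auto
qed

text \<open>No growth condition on \<open>Phi\<close> is imposed: the integrable upper bound is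
  \<open>step_progress\<close> itself, whose terms are integrable by the gradient bound and the
  assumption on \<open>Wstar\<close>, and the lower bound is \<open>- B\<close>.\<close>

lemma Phi_score_integrable:
  assumes w: "norm w \<le> R"
  shows "integrable D (\<lambda>z. Phi (score w (fst z)) (snd z))"
proof -
  define b where "b z = (V w - V (step w z)) / (2 * c)
      + c / 2 * (norm (tensor (grad w z) (psi (fst z))))\<^sup>2 + Phi (F *v Wstar (psi (fst z))) (snd z)" for z
  have b: "integrable D b"
    unfolding b_def using step_potential_integrable grad_sq_integrable(1)[OF w] Wstar_integrable
    by (intro Bochner_Integration.integrable_add) auto
  have "integrable D (\<lambda>z. \<bar>b z\<bar> + \<bar>B\<bar>)" using b by auto
  then show ?thesis
  proof (rule Bochner_Integration.integrable_bound)
    show "AE z in D. norm (Phi (score w (fst z)) (snd z)) \<le> norm (\<bar>b z\<bar> + \<bar>B\<bar>)"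
    proof (intro AE_I2)
      fix z
      show "norm (Phi (score w (fst z)) (snd z)) \<le> norm (\<bar>b z\<bar> + \<bar>B\<bar>)"
        using step_progress[of w z] Phi_ge[of "score w (fst z)" "snd z"] by (auto simp: b_def)
    qed
  qed measurable
qed

lemma excess_le:
  assumes w: "norm w \<le> R"
  shows "excess w \<le> (V w - (\<integral>z. V (step w z) \<partial>D)) / (2 * c) + c * M\<^sup>2 / 2"
proof -
  note int = step_potential_integrable[of w] grad_sq_integrable(1)[OF w]
  have "excess w \<le> (\<integral>z. (V w - V (step w z)) / (2 * c)
      + c / 2 * (norm (tensor (grad w z) (psi (fst z))))\<^sup>2 \<partial>D)"
    unfolding excess_def using int Wstar_integrable Phi_score_integrable[OF w]
    by (intro integral_mono step_progress Bochner_Integration.integrable_add) auto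
  also have "\<dots> = (V w - (\<integral>z. V (step w z) \<partial>D)) / (2 * c)
      + c / 2 * (\<integral>z. (norm (tensor (grad w z) (psi (fst z))))\<^sup>2 \<partial>D)"
    using int by (subst Bochner_Integration.integral_add) (auto simp: prob_space)
  also have "\<dots> \<le> (V w - (\<integral>z. V (step w z) \<partial>D)) / (2 * c) + c / 2 * M\<^sup>2"
    using grad_sq_integrable(2)[OF w] c_pos by (intro add_left_mono mult_left_mono) auto
  finally show ?thesis by simp
qed

text \<open>Uniformity over the ball makes the excess of a random iterate a bounded, hence
  integrable, function of the samples.\<close>

lemma excess_abs_le:
  obtains C where "\<And>w. norm w \<le> R \<Longrightarrow> \<bar>excess w\<bar> \<le> C"
proof
  fix w :: "'h^'r" assume w: "norm w \<le> R"
  define u where "u = (\<integral>z. Phi (F *v Wstar (psi (fst z))) (snd z) \<partial>D)"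
  have "(\<integral>z. - B \<partial>D) \<le> (\<integral>z. Phi (score w (fst z)) (snd z) \<partial>D)"
    by (intro integral_mono Phi_score_integrable[OF w] Phi_ge) auto
  then have "- B - u \<le> excess w"
    unfolding excess_def u_def using Phi_score_integrable[OF w] Wstar_integrable by (simp add: prob_space)
  moreover have "excess w \<le> 4 * R\<^sup>2 / (2 * c) + c * M\<^sup>2 / 2"
  proof -
    have "0 \<le> (\<integral>z. V (step w z) \<partial>D)" by (simp add: step_potential_bounds)
    then have "(V w - (\<integral>z. V (step w z) \<partial>D)) / (2 * c) \<le> 4 * R\<^sup>2 / (2 * c)"
      using potential_le[OF W w] c_pos by (intro divide_right_mono) auto
    then show ?thesis using excess_le[OF w] by simp
  qed
  ultimately show "\<bar>excess w\<bar> \<le> max (B + u) (4 * R\<^sup>2 / (2 * c) + c * M\<^sup>2 / 2)"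
    by (auto simp: u_def)
qed

text \<open>Scores are linear in \<open>w\<close> and \<open>Phi\<close> is convex in the score, so
  this is Jensen's inequality with equal weights, integrated over \<open>D\<close>.\<close>

lemma excess_avg_le:
  fixes w :: "'i \<Rightarrow> 'h^'r"
  assumes I: "finite I" "I \<noteq> {}" and w: "\<And>t. t \<in> I \<Longrightarrow> norm (w t) \<le> R"
    and avg: "norm ((1 / real (card I)) *\<^sub>R (\<Sum>t\<in>I. w t)) \<le> R"
  shows "excess ((1 / real (card I)) *\<^sub>R (\<Sum>t\<in>I. w t)) \<le> (\<Sum>t\<in>I. excess (w t)) / real (card I)"
proof -
  define n where "n = real (card I)"
  have n: "n > 0" using I by (auto simp: n_def card_gt_0_iff)
  let ?s = "\<lambda>z. Phi (F *v Wstar (psi (fst z))) (snd z)"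
  have "excess ((1 / n) *\<^sub>R (\<Sum>t\<in>I. w t))
      \<le> (\<integral>z. (\<Sum>t\<in>I. (1 / n) * (Phi (score (w t) (fst z)) (snd z) - ?s z)) \<partial>D)"
    unfolding excess_def
  proof (intro integral_mono)
    fix z :: "'x \<times> 'k"
    define x y where "x = fst z" and "y = snd z"
    have "score ((1 / n) *\<^sub>R (\<Sum>t\<in>I. w t)) x = (\<Sum>t\<in>I. (1 / n) *\<^sub>R score (w t) x)"
      by (simp add: hs_op_simps hs_op_sum matrix_vector_mult_scaleR scaleR_sum_right
          linear_sum[OF matrix_vector_mul_linear])
    then have "Phi (score ((1 / n) *\<^sub>R (\<Sum>t\<in>I. w t)) x) y \<le> (\<Sum>t\<in>I. (1 / n) * Phi (score (w t) x) y)"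
      using convex_on_sum[OF I Phi_convex[of y], of "\<lambda>_. 1 / n" "\<lambda>t. score (w t) x"] n
      by (simp add: n_def)
    moreover have "(\<Sum>t\<in>I. (1 / n) * (Phi (score (w t) x) y - ?s z))
        = (\<Sum>t\<in>I. (1 / n) * Phi (score (w t) x) y) - ?s z"
      using n by (simp add: right_diff_distrib sum_subtractf n_def)
    ultimately show "Phi (score ((1 / n) *\<^sub>R (\<Sum>t\<in>I. w t)) (fst z)) (snd z) - ?s z
        \<le> (\<Sum>t\<in>I. (1 / n) * (Phi (score (w t) (fst z)) (snd z) - ?s z))"
      by (simp add: x_def y_def)
  qed (use w avg Phi_score_integrable Wstar_integrable in \<open>auto simp: n_def\<close>)
  also have "\<dots> = (\<Sum>t\<in>I. (1 / n) * excess (w t))"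
    unfolding excess_def using w Phi_score_integrable Wstar_integrable
    by (subst Bochner_Integration.integral_sum) auto
  finally show ?thesis by (simp add: n_def sum_divide_distrib)
qed

lemma excess_asgd_avg:
  fixes N :: nat
  assumes N: "0 < N"
  defines "avg \<equiv> \<lambda>s. (1 / real N) *\<^sub>R (\<Sum>t\<in>{1..N}. iter s t)"
  shows "integrable (PiM {1..N} (\<lambda>_. D)) (\<lambda>s. \<Sum>t\<in>{1..N}. excess (iter s t))" (is ?A)
    and "(\<integral>s. (\<Sum>t\<in>{1..N}. excess (iter s t)) \<partial>PiM {1..N} (\<lambda>_. D))
      \<le> 4 * R\<^sup>2 / (2 * c) + real N * (c * M\<^sup>2 / 2)" (is ?B)
proof -
  let ?P = "PiM {1..N} (\<lambda>_. D)"
  interpret P: prob_space ?P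
    by (intro prob_space_PiM) unfold_locales
  have R: "0 \<le> R" using R_pos by simp
  obtain C where C: "\<And>w. norm w \<le> R \<Longrightarrow> \<bar>excess w\<bar> \<le> C" using excess_abs_le by blast
  have int: "integrable ?P (\<lambda>s. excess (iter s t))" if "t \<in> {1..N}" for t
    using that
    by (intro P.integrable_const_bound[of _ C] measurable_excess weakly_measurable_iter)
      (auto intro!: C norm_sgd_iter[OF R])
  then show ?A by (intro Bochner_Integration.integrable_sum)
  define a where "a t = (\<integral>s. V (iter s t) \<partial>?P)" for t
  \<comment> \<open>In \<open>b t\<close> the step uses a sample independent of all of
    \<open>s\<close>, so that \<open>b N\<close> makes sense although \<open>s\<close> carries only
    \<open>N\<close> samples.\<close>
  define b where "b t = (\<integral>s. \<integral>z. V (step (iter s t) z) \<partial>D \<partial>?P)" for t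
  have jm[measurable]: "(\<lambda>(s, z). V (step (iter s t) z)) \<in> borel_measurable (?P \<Otimes>\<^sub>M D)" if "t \<in> {1..N}" for t
  proof -
    have "weakly_measurable (?P \<Otimes>\<^sub>M D) (\<lambda>p. step (iter (fst p) t) (snd p))"
      using that by (intro weakly_measurable_step weakly_measurable_compose[OF weakly_measurable_iter]) auto
    from measurable_potential[OF this] show ?thesis by (simp add: case_prod_beta')
  qed
  have intV: "integrable ?P (\<lambda>s. V (iter s t))" if "t \<in> {1..N}" for t
    using that
    by (intro P.integrable_const_bound[of _ "4 * R\<^sup>2"] measurable_potential weakly_measurable_iter)
      (auto intro!: potential_le[OF W] norm_sgd_iter[OF R] simp: potential_nonneg[OF W])
  have stepbd: "\<bar>\<integral>z. V (step w z) \<partial>D\<bar> \<le> 4 * R\<^sup>2" for w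
  proof -
    have "0 \<le> (\<integral>z. V (step w z) \<partial>D)" by (simp add: step_potential_bounds)
    moreover have "(\<integral>z. V (step w z) \<partial>D) \<le> (\<integral>z. 4 * R\<^sup>2 \<partial>D)"
      by (intro integral_mono step_potential_integrable step_potential_bounds) auto
    ultimately show ?thesis by (simp add: prob_space)
  qed
  have intS: "integrable ?P (\<lambda>s. \<integral>z. V (step (iter s t) z) \<partial>D)" if "t \<in> {1..N}" for t
    using jm[OF that] stepbd
    by (intro P.integrable_const_bound[of _ "4 * R\<^sup>2"] borel_measurable_lebesgue_integral) auto
  have "(\<integral>s. excess (iter s t) \<partial>?P) \<le> (a t - b t) / (2 * c) + c * M\<^sup>2 / 2" if t: "t \<in> {1..N}" for t
  proof -
    have "(\<integral>s. excess (iter s t) \<partial>?P)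
        \<le> (\<integral>s. (V (iter s t) - (\<integral>z. V (step (iter s t) z) \<partial>D)) / (2 * c) + c * M\<^sup>2 / 2 \<partial>?P)"
      using t int intV intS
      by (intro integral_mono excess_le norm_sgd_iter[OF R] Bochner_Integration.integrable_add
          P.integrable_const) auto
    then show ?thesis
      using intV[OF t] intS[OF t] by (simp add: a_def b_def P.prob_space del: One_nat_def)
  qed
  then have "(\<Sum>t\<in>{1..N}. \<integral>s. excess (iter s t) \<partial>?P)
      \<le> (\<Sum>t\<in>{1..N}. (a t - b t) / (2 * c) + c * M\<^sup>2 / 2)"
    by (intro sum_mono)
  also have "\<dots> = (\<Sum>t\<in>{1..N}. a t - b t) / (2 * c) + real N * (c * M\<^sup>2 / 2)"
    by (simp add: sum.distrib sum_divide_distrib)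
  also have "(\<Sum>t\<in>{1..N}. a t - b t) \<le> 4 * R\<^sup>2"
  proof -
    \<comment> \<open>For \<open>t < N\<close> the fresh sample can be identified with sample
      \<open>Suc t\<close>, which \<open>iter s t\<close> has not read.\<close>
    have resample: "b t = a (Suc t)" if "t \<in> {1..<N}" for t
    proof -
      have "(\<integral>s. (\<lambda>(s, z). V (step (iter s t) z)) (s, s (Suc t)) \<partial>?P)
          = (\<integral>s. \<integral>z. (\<lambda>(s, z). V (step (iter s t) z)) (s, z) \<partial>D \<partial>?P)"
      proof (rule integral_PiM_resample)
        fix s z' z
        have "iter (s(Suc t := z')) t = iter s t" by (rule sgd_iter_cong) auto
        then show "(\<lambda>(s, z). V (step (iter s t) z)) (s(Suc t := z'), z) = (\<lambda>(s, z). V (step (iter s t) z)) (s, z)"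
          by simp
      qed (use that jm step_potential_bounds prob_space_axioms in auto)
      then show ?thesis by (simp add: a_def b_def)
    qed
    have "(\<Sum>t\<in>{1..N}. a t - b t) = (\<Sum>t\<in>{1..<N}. a t - a (Suc t)) + (a N - b N)"
    proof -
      have "{1..N} = insert N {1..<N}" using N by auto
      then show ?thesis using resample by simp
    qed
    also have "(\<Sum>t\<in>{1..<N}. a t - a (Suc t)) = a 1 - a N"
      using sum_Suc_diff'[of 1 N "\<lambda>t. - a t"] N by simp
    finally have "(\<Sum>t\<in>{1..N}. a t - b t) = a 1 - b N" by simp
    moreover have "a 1 \<le> (\<integral>s. 4 * R\<^sup>2 \<partial>?P)"
      unfolding a_def using N
      by (intro integral_mono intV P.integrable_const potential_le[OF W] norm_sgd_iter[OF R]) auto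
    \<comment> \<open>The virtual step contributes nothing but the sign of its potential.\<close>
    moreover have "0 \<le> b N" unfolding b_def by (simp add: step_potential_bounds)
    ultimately show ?thesis by (simp add: P.prob_space del: One_nat_def)
  qed
  finally show ?B
    using int c_pos by (subst Bochner_Integration.integral_sum) (auto simp: divide_right_mono)
qed

end

section \<open>Calibration\<close>

text \<open>The slope is the infimum of the difference quotients to the right of \<open>e\<close>,
  that is, the right derivative. Monotonicity makes it nonnegative, and \<open>0 < e\<close> places
  \<open>e\<close> in the interior, where convexity yields the supporting line.\<close>

lemma convex_mono_support_line:
  fixes H :: "real \<Rightarrow> real"
  assumes H: "convex_on {0..} H" "mono_on {0..} H" and e: "0 < e"
  obtains c where "0 \<le> c" "\<And>u. 0 \<le> u \<Longrightarrow> H e + c * (u - e) \<le> H u"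
proof
  define S where "S = (\<lambda>t. (H e - H t) / (e - t)) ` ({e<..} \<inter> {0..})"
  have "e + 1 \<in> {e<..} \<inter> {0..}" using e by auto
  then have ne: "S \<noteq> {}" unfolding S_def by blast
  have "0 \<le> s" if s: "s \<in> S" for s
  proof -
    obtain t where t: "t > e" "s = (H e - H t) / (e - t)" using s unfolding S_def by blast
    have "H e \<le> H t" using t e by (intro mono_onD[OF H(2)]) auto
    then show ?thesis using t by (simp add: divide_nonpos_neg)
  qed
  then show "0 \<le> Inf S" using ne by (intro cInf_greatest)
  fix u :: real assume u: "0 \<le> u"
  have "e \<in> interior {0..}" using e by simp
  from convex_le_Inf_differential[OF H(1) this, of u] u
  show "H e + Inf S * (u - e) \<le> H u" by (simp add: S_def)
qed

text \<open>The maximisers form a finite nonempty set, so \<open>LEAST\<close> is its minimum. The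
  right side consists of finitely many coordinate comparisons, from which Borel measurability of
  \<open>pred\<close> follows.\<close>

lemma pred_eq_iff:
  "pred f = c \<longleftrightarrow> (\<forall>c'. f $ c' \<le> f $ c) \<and> (\<forall>a. (\<forall>c'. f $ c' \<le> f $ a) \<longrightarrow> c \<le> a)"
proof -
  define A where "A = {c. \<forall>c'. f $ c' \<le> f $ c}"
  have "finite (range (($) f))" by simp
  then have "Max (range (($) f)) \<in> range (($) f)" by (intro Max_in) auto
  then obtain a where "f $ a = Max (range (($) f))" by (metis rangeE)
  then have "a \<in> A" by (auto simp: A_def)
  then have A: "finite A" "A \<noteq> {}" by auto
  have "pred f = Min A"
    unfolding pred_def using Min_in[OF A] Min_le[OF A(1)]
    by (intro Least_equality) (auto simp: A_def)
  then have "pred f = c \<longleftrightarrow> c \<in> A \<and> (\<forall>a\<in>A. c \<le> a)"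
    using Min_eq_iff[OF A, of c] by auto
  then show ?thesis by (auto simp: A_def)
qed

lemma measurable_vec_nth[measurable (raw)]:
  fixes f :: "'a \<Rightarrow> real^'n::finite"
  assumes "f \<in> borel_measurable M"
  shows "(\<lambda>x. f x $ i) \<in> borel_measurable M"
  by (rule borel_measurable_continuous_on[OF _ assms]) (intro continuous_intros)

lemma measurable_pred[measurable]: "(pred :: real^'k::{finite,linorder} \<Rightarrow> 'k) \<in> borel \<rightarrow>\<^sub>M count_space UNIV"
proof (subst measurable_count_space_eq2, simp, intro conjI ballI)
  fix c :: 'k
  have "{f \<in> space (borel :: (real^'k::{finite,linorder}) measure). (\<forall>c'. f $ c' \<le> f $ c) \<and> (\<forall>a. (\<forall>c'. f $ c' \<le> f $ a) \<longrightarrow> c \<le> a)} \<in> sets borel"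
    by measurable
  then show "pred -` {c} \<inter> space borel \<in> sets borel"
    by (simp add: vimage_def pred_eq_iff)
qed auto

text \<open>Because labels are finite, one Radon--Nikodym derivative per label replaces a regular
  conditional probability, and no topology on the input space is required: the part of
  \<open>D\<close> with label \<open>c\<close>, pushed to inputs, is dominated by the input
  marginal.\<close>

lemma label_disintegration:
  fixes D :: "('x \<times> 'k::finite) measure"
  assumes D: "prob_space D" and sets[measurable_cong]: "sets D = sets (MX \<Otimes>\<^sub>M count_space UNIV)"
  obtains q :: "'x \<Rightarrow> real^'k"
  where "q \<in> borel_measurable MX" "\<And>x. q x \<in> prob_simplex"
    "\<And>c. distr (density D (\<lambda>z. ennreal (indicator {c} (snd z)))) MX fst
       = density (distr D MX fst) (\<lambda>x. ennreal (q x $ c))"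
proof -
  interpret D: prob_space D by fact
  have fst[measurable]: "fst \<in> D \<rightarrow>\<^sub>M MX"
    by (subst measurable_cong_sets[OF sets refl]) measurable
  have snd[measurable]: "snd \<in> D \<rightarrow>\<^sub>M count_space UNIV"
    by (subst measurable_cong_sets[OF sets refl]) measurable
  define P where "P = distr D MX fst"
  interpret P: prob_space P unfolding P_def by (intro D.prob_space_distr fst)
  have [measurable_cong]: "sets P = sets MX" by (simp add: P_def)
  define \<mu> where "\<mu> c = distr (density D (\<lambda>z. ennreal (indicator {c} (snd z)))) MX fst" for c
  have \<mu>_sets: "sets (\<mu> c) = sets MX" for c by (simp add: \<mu>_def)
  have \<mu>: "emeasure (\<mu> c) A = (\<integral>\<^sup>+z. indicator {c} (snd z) * indicator A (fst z) \<partial>D)"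
    if [measurable]: "A \<in> sets MX" for A c
  proof -
    have m: "fst \<in> density D (\<lambda>z. ennreal (indicator {c} (snd z))) \<rightarrow>\<^sub>M MX" by simp
    have "fst -` A \<inter> space D \<in> sets D" by measurable
    then show ?thesis
      unfolding \<mu>_def emeasure_distr[OF m that]
      by (simp add: emeasure_density ennreal_indicator)
        (auto intro!: nn_integral_cong split: split_indicator)
  qed
  have P: "emeasure P A = (\<integral>\<^sup>+z. indicator A (fst z) \<partial>D)" if "A \<in> sets MX" for A
    unfolding P_def using that by (simp flip: nn_integral_indicator add: nn_integral_distr)
  have ac: "absolutely_continuous P (\<mu> c)" for c
    unfolding absolutely_continuous_def
  proof
    fix A assume A: "A \<in> null_sets P"
    then have [measurable]: "A \<in> sets MX" by (auto simp: null_sets_def P_def)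
    have "emeasure (\<mu> c) A \<le> emeasure P A"
      unfolding \<mu>[OF \<open>A \<in> sets MX\<close>] P[OF \<open>A \<in> sets MX\<close>]
      by (intro nn_integral_mono) (auto split: split_indicator)
    then show "A \<in> null_sets (\<mu> c)" using A by (auto simp: null_sets_def \<mu>_sets)
  qed
  define p where "p c = RN_deriv P (\<mu> c)" for c
  have [measurable]: "p c \<in> borel_measurable MX" for c
    unfolding p_def using borel_measurable_RN_deriv[of P "\<mu> c"] by (simp add: P_def)
  have p: "density P (p c) = \<mu> c" for c
    unfolding p_def by (intro P.density_RN_deriv ac) (simp add: \<mu>_sets P_def)
  \<comment> \<open>The label parts add up to the marginal, so by uniqueness of densities the
    derivatives sum to 1 almost everywhere.\<close>
  have "density P (\<lambda>x. \<Sum>c\<in>UNIV. p c x) = density P (\<lambda>_. 1)"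
  proof (rule measure_eqI)
    fix A assume "A \<in> sets (density P (\<lambda>x. \<Sum>c\<in>UNIV. p c x))"
    then have A[measurable]: "A \<in> sets MX" by (simp add: P_def)
    have "emeasure (density P (\<lambda>x. \<Sum>c\<in>UNIV. p c x)) A = (\<Sum>c\<in>UNIV. emeasure (density P (p c)) A)"
      by (simp add: emeasure_density nn_integral_sum[symmetric] sum_distrib_right)
    also have "\<dots> = (\<integral>\<^sup>+z. (\<Sum>c\<in>UNIV. indicator {c} (snd z) * indicator A (fst z)) \<partial>D)"
      unfolding p \<mu>[OF A] by (rule nn_integral_sum[symmetric]) measurable
    also have "\<dots> = emeasure P A"
      unfolding P[OF A] by (intro nn_integral_cong) (simp add: indicator_def flip: sum_distrib_right)
    finally show "emeasure (density P (\<lambda>x. \<Sum>c\<in>UNIV. p c x)) A = emeasure (density P (\<lambda>_. 1)) A"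
      by (simp add: density_1)
  qed simp
  then have AE1: "AE x in P. (\<Sum>c\<in>UNIV. p c x) = 1"
    by (subst (asm) P.density_unique_iff) auto
  \<comment> \<open>On the exceptional null set a point mass at an arbitrary label is used. Thus
    every \<open>q x\<close> lies in the simplex, and calibration can be applied at every
    input.\<close>
  define q :: "'x \<Rightarrow> real^'k" where
    "q x = (if (\<Sum>c\<in>UNIV. p c x) = 1 then (\<chi> c. enn2real (p c x)) else axis (SOME c. True) 1)" for x
  have fin: "p c x < \<infinity>" if "(\<Sum>c\<in>UNIV. p c x) = 1" for c x
  proof -
    have "p c x \<le> (\<Sum>c\<in>UNIV. p c x)" by (intro member_le_sum) auto
    then show ?thesis using that by (auto simp: le_less_trans)
  qed
  show thesis
  proof
    have [measurable]: "(\<lambda>x. \<chi> c. enn2real (p c x)) \<in> borel_measurable MX"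
      by (subst borel_measurable_euclidean_space) (auto simp: Basis_vec_def inner_axis)
    show "q \<in> borel_measurable MX" unfolding q_def by measurable
    show "q x \<in> prob_simplex" for x
    proof (cases "(\<Sum>c\<in>UNIV. p c x) = 1")
      case True
      have "ennreal (\<Sum>c\<in>UNIV. enn2real (p c x)) = (\<Sum>c\<in>UNIV. p c x)"
        using fin[OF True] by (simp flip: sum_ennreal)
      then have "ennreal (\<Sum>c\<in>UNIV. enn2real (p c x)) = ennreal 1" using True by simp
      then have "(\<Sum>c\<in>UNIV. enn2real (p c x)) = 1"
        by (subst (asm) ennreal_inj) (auto intro: sum_nonneg)
      then show ?thesis by (simp add: q_def True prob_simplex_def)
    next
      case False
      then show ?thesis by (simp add: q_def prob_simplex_def axis_def)
    qed
    fix c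
    have "density P (\<lambda>x. ennreal (q x $ c)) = density P (p c)"
    proof (intro density_cong)
      show "AE x in P. ennreal (q x $ c) = p c x"
        using AE1 by eventually_elim (use fin in \<open>simp add: q_def\<close>)
    qed (use \<open>q \<in> borel_measurable MX\<close> in \<open>auto simp: P_def\<close>)
    then show "distr (density D (\<lambda>z. ennreal (indicator {c} (snd z)))) MX fst
       = density (distr D MX fst) (\<lambda>x. ennreal (q x $ c))"
      unfolding p by (simp add: \<mu>_def P_def)
  qed
qed

section \<open>The extended-real surrogate risk and the Bochner integral\<close>

lemma risk_Phi_eq_integral:
  assumes "integrable D (\<lambda>z. Phi (f (fst z)) (snd z))"
  shows "risk_Phi Phi D f = ereal (\<integral>z. Phi (f (fst z)) (snd z) \<partial>D)"
proof -
  have max0: "ennreal (max 0 r) = ennreal r" for r :: real by (simp add: max_def ennreal_neg)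
  let ?u = "\<lambda>z. Phi (f (fst z)) (snd z)"
  have "(\<integral>\<^sup>+z. ennreal (?u z) \<partial>D) \<noteq> \<infinity>" "(\<integral>\<^sup>+z. ennreal (- ?u z) \<partial>D) \<noteq> \<infinity>"
    using assms by (auto simp: real_integrable_def)
  then show ?thesis
    unfolding risk_Phi_def max0 real_lebesgue_integral_def[OF assms]
    by (cases "\<integral>\<^sup>+z. ennreal (?u z) \<partial>D"; cases "\<integral>\<^sup>+z. ennreal (- ?u z) \<partial>D")
      (auto simp: enn2ereal_ennreal)
qed

text \<open>The lower bound makes the negative part finite, so a risk other than infinity forces the
  positive part to be finite too.\<close>

lemma integrable_if_risk_Phi_finite:
  assumes "prob_space D" and meas[measurable]: "(\<lambda>z. Phi (f (fst z)) (snd z)) \<in> borel_measurable D"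
    and ge: "\<And>f y. - B \<le> Phi f y" and fin: "risk_Phi Phi D f \<noteq> \<infinity>"
  shows "integrable D (\<lambda>z. Phi (f (fst z)) (snd z))"
proof -
  interpret prob_space D by fact
  have max0: "ennreal (max 0 r) = ennreal r" for r :: real by (simp add: max_def ennreal_neg)
  let ?u = "\<lambda>z. Phi (f (fst z)) (snd z)"
  have "(\<integral>\<^sup>+z. ennreal (- ?u z) \<partial>D) \<le> (\<integral>\<^sup>+z. ennreal B \<partial>D)"
    using ge by (intro nn_integral_mono ennreal_leI) (simp add: minus_le_iff)
  then have neg: "(\<integral>\<^sup>+z. ennreal (- ?u z) \<partial>D) \<noteq> \<infinity>"
    by (auto simp: emeasure_space_1 top_unique)
  then have "(\<integral>\<^sup>+z. ennreal (?u z) \<partial>D) \<noteq> \<infinity>"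
    using fin unfolding risk_Phi_def max0
    by (cases "\<integral>\<^sup>+z. ennreal (- ?u z) \<partial>D") (auto simp: enn2ereal_ennreal)
  with neg show ?thesis by (simp add: real_integrable_def)
qed

section \<open>Integration against conditional label distributions\<close>

locale label_kernel = labelled_distribution D MX
  for D :: "('x \<times> 'k::finite) measure" and MX :: "'x measure" +
  fixes q :: "'x \<Rightarrow> real^'k"
  assumes q_meas[measurable]: "q \<in> borel_measurable MX"
    and q_simplex: "\<And>x. q x \<in> prob_simplex"
    and q_density: "\<And>c. distr (density D (\<lambda>z. ennreal (indicator {c} (snd z)))) MX fst
       = density (distr D MX fst) (\<lambda>x. ennreal (q x $ c))"
begin

abbreviation P where "P \<equiv> distr D MX fst"

lemma q_nonneg: "0 \<le> q x $ c" and q_sum: "(\<Sum>c\<in>UNIV. q x $ c) = 1"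
  using q_simplex[of x] by (auto simp: prob_simplex_def)

lemma q_le_1: "q x $ c \<le> 1"
  using member_le_sum[of c UNIV "\<lambda>c. q x $ c"] q_nonneg q_sum by auto

lemma prob_space_P: "prob_space P"
  by (intro prob_space_distr) measurable

lemma measurable_slice:
  assumes "u \<in> borel_measurable D"
  shows "(\<lambda>x. u (x, c)) \<in> borel_measurable MX"
proof -
  have "(\<lambda>x. (x, c)) \<in> MX \<rightarrow>\<^sub>M D"
    by (subst measurable_cong_sets[OF refl D_sets]) measurable
  from measurable_compose[OF this assms] show ?thesis .
qed

text \<open>Split \<open>u\<close> by label. On the part with label \<open>c\<close> it is a
  function of the input alone, and \<open>q_density\<close> turns its integral into one against the
  marginal.\<close>

lemma integral_disintegrate:
  fixes u :: "'x \<times> 'k \<Rightarrow> real"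
  assumes u: "integrable D u"
  shows "integrable P (\<lambda>x. \<Sum>c\<in>UNIV. q x $ c * u (x, c))"
    and "(\<integral>z. u z \<partial>D) = (\<integral>x. (\<Sum>c\<in>UNIV. q x $ c * u (x, c)) \<partial>P)"
proof -
  have um[measurable]: "u \<in> borel_measurable D" using u by simp
  note measurable_slice[OF um, measurable]
  have slice: "indicator {c} (snd z) * u (fst z, c) = indicator {c} (snd z) * u z" for c z
    by (cases z) (auto split: split_indicator)
  have *: "integrable D (\<lambda>z. indicator {c} (snd z) * u z)" for c
    by (rule Bochner_Integration.integrable_bound[OF u]) (auto split: split_indicator)
  have d: "integrable P (\<lambda>x. q x $ c * u (x, c))
      \<and> (\<integral>x. q x $ c * u (x, c) \<partial>P) = (\<integral>z. indicator {c} (snd z) * u z \<partial>D)" for c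
  proof -
    have m: "fst \<in> density D (\<lambda>z. ennreal (indicator {c} (snd z))) \<rightarrow>\<^sub>M MX" by simp
    have "integrable (density D (\<lambda>z. ennreal (indicator {c} (snd z)))) (\<lambda>z. u (fst z, c))"
      using *[of c] by (subst integrable_density) (auto simp: slice)
    then have "integrable (density P (\<lambda>x. ennreal (q x $ c))) (\<lambda>x. u (x, c))"
      unfolding q_density[symmetric] by (subst integrable_distr_eq[OF m]) auto
    then have 1: "integrable P (\<lambda>x. q x $ c * u (x, c))"
      by (subst (asm) integrable_density) (auto simp: q_nonneg)
    have "(\<integral>x. q x $ c * u (x, c) \<partial>P) = (\<integral>x. u (x, c) \<partial>density P (\<lambda>x. ennreal (q x $ c)))"
      by (subst integral_density) (auto simp: q_nonneg)
    also have "\<dots> = (\<integral>z. indicator {c} (snd z) * u z \<partial>D)"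
      unfolding q_density[symmetric]
      by (subst integral_distr[OF m]) (auto simp: integral_density slice)
    finally show ?thesis using 1 by simp
  qed
  then show "integrable P (\<lambda>x. \<Sum>c\<in>UNIV. q x $ c * u (x, c))"
    by (intro Bochner_Integration.integrable_sum) auto
  have "(\<integral>z. u z \<partial>D) = (\<integral>z. (\<Sum>c\<in>UNIV. indicator {c} (snd z) * u z) \<partial>D)"
    by (simp add: indicator_def flip: sum_distrib_right)
  also have "\<dots> = (\<integral>x. (\<Sum>c\<in>UNIV. q x $ c * u (x, c)) \<partial>P)"
    using d by (subst (1 2) Bochner_Integration.integral_sum) (auto simp: *)
  finally show "(\<integral>z. u z \<partial>D) = (\<integral>x. (\<Sum>c\<in>UNIV. q x $ c * u (x, c)) \<partial>P)" .
qed

text \<open>This nonnegative version serves in \<open>opt_risk_Phi_le\<close>, where integrability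
  of the selected score function still has to be proved.\<close>

lemma nn_integral_disintegrate:
  fixes u :: "'x \<times> 'k \<Rightarrow> ennreal"
  assumes u[measurable]: "u \<in> borel_measurable D"
  shows "(\<integral>\<^sup>+z. u z \<partial>D) = (\<integral>\<^sup>+x. (\<Sum>c\<in>UNIV. ennreal (q x $ c) * u (x, c)) \<partial>P)"
proof -
  note measurable_slice[OF u, measurable]
  have slice: "indicator {c} (snd z) * u (fst z, c) = indicator {c} (snd z) * u z" for c z
    by (cases z) (auto split: split_indicator)
  have d: "(\<integral>\<^sup>+x. ennreal (q x $ c) * u (x, c) \<partial>P) = (\<integral>\<^sup>+z. indicator {c} (snd z) * u z \<partial>D)" for c
  proof -
    have m: "fst \<in> density D (\<lambda>z. ennreal (indicator {c} (snd z))) \<rightarrow>\<^sub>M MX" by simp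
    have "(\<integral>\<^sup>+x. ennreal (q x $ c) * u (x, c) \<partial>P)
        = (\<integral>\<^sup>+x. u (x, c) \<partial>density P (\<lambda>x. ennreal (q x $ c)))"
      by (subst nn_integral_density) auto
    also have "\<dots> = (\<integral>\<^sup>+z. indicator {c} (snd z) * u z \<partial>D)"
      unfolding q_density[symmetric]
      by (subst nn_integral_distr[OF m]) (auto simp: nn_integral_density slice ennreal_indicator)
    finally show ?thesis .
  qed
  have "(\<integral>\<^sup>+z. u z \<partial>D) = (\<integral>\<^sup>+z. (\<Sum>c\<in>UNIV. indicator {c} (snd z) * u z) \<partial>D)"
    by (simp add: indicator_def flip: sum_distrib_right)
  also have "\<dots> = (\<integral>\<^sup>+x. (\<Sum>c\<in>UNIV. ennreal (q x $ c) * u (x, c)) \<partial>P)"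
    by (subst (1 2) nn_integral_sum) (auto simp: d)
  finally show ?thesis .
qed

end

section \<open>Pointwise optimal losses and optimal risks\<close>

locale surrogate_problem = label_kernel D MX q + surrogate_loss Phi B
  for D :: "('x \<times> 'k::{finite,linorder}) measure" and MX q
    and Phi :: "real^'k::{finite,linorder} \<Rightarrow> 'k \<Rightarrow> real" and B :: real +
  fixes L :: "'k \<Rightarrow> 'k \<Rightarrow> real" and F :: "real^'r::finite^'k::{finite,linorder}"
  assumes L_nonneg: "\<And>c c'. 0 \<le> L c c'"
begin

abbreviation FS where "FS \<equiv> range ((*v) F)"

lemma zero_in_FS: "0 \<in> FS"
  by (metis matrix_vector_mult_0_right rangeI)

definition best_surr :: "'x \<Rightarrow> real" where
  "best_surr x = (INF f\<in>FS. cond_surr_loss Phi f (q x))"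

definition best_task :: "'x \<Rightarrow> real" where
  "best_task x = (INF f\<in>FS. cond_task_loss L f (q x))"

lemma cond_surr_ge: "- B \<le> cond_surr_loss Phi f (q x)"
proof -
  have "- B = (\<Sum>c\<in>UNIV. q x $ c * - B)"
    by (simp add: q_sum sum_negf flip: sum_distrib_right)
  also have "\<dots> \<le> cond_surr_loss Phi f (q x)"
    unfolding cond_surr_loss_def by (intro sum_mono mult_left_mono Phi_ge q_nonneg)
  finally show ?thesis .
qed

lemma cond_surr_bdd: "bdd_below ((\<lambda>f. cond_surr_loss Phi f (q x)) ` S)"
  by (intro bdd_belowI[of _ "- B"]) (auto simp: cond_surr_ge)

lemma cond_surr_meas[measurable (raw)]:
  assumes [measurable]: "f \<in> borel_measurable MX"
  shows "(\<lambda>x. cond_surr_loss Phi (f x) (q x)) \<in> borel_measurable MX"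
  unfolding cond_surr_loss_def by measurable

text \<open>Strict sublevel sets of the continuous conditional loss are open in parameter space and
  so meet a countable dense set. A countable infimum is measurable in \<open>x\<close> and allows
  selection by least index.\<close>

lemma dense_enumeration:
  obtains d :: "nat \<Rightarrow> real^'r" where
    "\<And>x. best_surr x = (INF i. cond_surr_loss Phi (F *v d i) (q x))"
proof -
  obtain Q :: "(real^'r) set" where Q: "countable Q" "\<And>X. open X \<Longrightarrow> X \<noteq> {} \<Longrightarrow> \<exists>d\<in>Q. d \<in> X"
    using countable_dense_setE by metis
  have Qne: "Q \<noteq> {}" using Q(2)[of UNIV] by auto
  define d where "d = from_nat_into Q"
  have d: "range d = Q" unfolding d_def by (rule range_from_nat_into[OF Qne Q(1)])
  have "best_surr x = (INF i. cond_surr_loss Phi (F *v d i) (q x))" for x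
  proof (rule antisym)
    show "best_surr x \<le> (INF i. cond_surr_loss Phi (F *v d i) (q x))"
      unfolding best_surr_def by (intro cINF_greatest cINF_lower cond_surr_bdd) auto
    have "(INF i. cond_surr_loss Phi (F *v d i) (q x)) \<le> cond_surr_loss Phi (F *v v) (q x)" for v
    proof (rule field_le_epsilon)
      fix e :: real assume e: "0 < e"
      have "continuous_on UNIV (\<lambda>f. cond_surr_loss Phi f (q x))"
        unfolding cond_surr_loss_def by (intro continuous_intros Phi_cont)
      then have "continuous_on UNIV (\<lambda>v. cond_surr_loss Phi (F *v v) (q x))"
        by (rule continuous_on_compose2)
          (auto intro!: linear_continuous_on simp: linear_conv_bounded_linear[symmetric])
      then have "open {v'. cond_surr_loss Phi (F *v v') (q x) < cond_surr_loss Phi (F *v v) (q x) + e}"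
        by (intro open_Collect_less continuous_intros)
      moreover have "v \<in> {v'. cond_surr_loss Phi (F *v v') (q x) < cond_surr_loss Phi (F *v v) (q x) + e}"
        using e by simp
      ultimately obtain w where "w \<in> Q" "cond_surr_loss Phi (F *v w) (q x) < cond_surr_loss Phi (F *v v) (q x) + e"
        using Q(2) by blast
      then obtain i where "cond_surr_loss Phi (F *v d i) (q x) < cond_surr_loss Phi (F *v v) (q x) + e"
        using d by blast
      moreover have "(INF i. cond_surr_loss Phi (F *v d i) (q x)) \<le> cond_surr_loss Phi (F *v d i) (q x)"
        using cond_surr_bdd[of x "(\<lambda>i. F *v d i) ` UNIV"] by (intro cINF_lower) (auto simp: image_image)
      ultimately show "(INF i. cond_surr_loss Phi (F *v d i) (q x)) \<le> cond_surr_loss Phi (F *v v) (q x) + e"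
        by simp
    qed
    then show "(INF i. cond_surr_loss Phi (F *v d i) (q x)) \<le> best_surr x"
      unfolding best_surr_def by (intro cINF_greatest) auto
  qed
  then show thesis using that by blast
qed

lemma best_surr_ge: "- B \<le> best_surr x"
  unfolding best_surr_def by (intro cINF_greatest cond_surr_ge) auto

lemma best_surr_integrable: "integrable P best_surr"
proof -
  interpret P: prob_space P by (rule prob_space_P)
  obtain d :: "nat \<Rightarrow> real^'r" where d: "\<And>x. best_surr x = (INF i. cond_surr_loss Phi (F *v d i) (q x))"
    using dense_enumeration by blast
  have [measurable]: "best_surr \<in> borel_measurable MX"
    unfolding d using cond_surr_bdd[of _ "(\<lambda>i. F *v d i) ` UNIV"]
    by (intro borel_measurable_cINF) (auto simp: image_image)
  have "best_surr x \<le> (\<Sum>c\<in>UNIV. \<bar>Phi 0 c\<bar>)" for x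
  proof -
    have "best_surr x \<le> cond_surr_loss Phi 0 (q x)"
      unfolding best_surr_def by (intro cINF_lower cond_surr_bdd zero_in_FS)
    also have "\<dots> \<le> (\<Sum>c\<in>UNIV. \<bar>Phi 0 c\<bar>)"
      unfolding cond_surr_loss_def
    proof (intro sum_mono)
      fix c
      have "q x $ c * Phi 0 c \<le> q x $ c * \<bar>Phi 0 c\<bar>"
        by (intro mult_left_mono q_nonneg) simp
      also have "\<dots> \<le> 1 * \<bar>Phi 0 c\<bar>"
        by (intro mult_right_mono q_le_1) simp
      finally show "q x $ c * Phi 0 c \<le> \<bar>Phi 0 c\<bar>" by simp
    qed
    finally show ?thesis .
  qed
  then have "\<bar>best_surr x\<bar> \<le> max \<bar>B\<bar> (\<Sum>c\<in>UNIV. \<bar>Phi 0 c\<bar>)" for x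
    using best_surr_ge[of x] by (smt (verit))
  then show ?thesis
    by (intro P.integrable_const_bound[of _ "max \<bar>B\<bar> (\<Sum>c\<in>UNIV. \<bar>Phi 0 c\<bar>)"]) auto
qed

lemma cond_surr_eq_integral:
  assumes "integrable D (\<lambda>z. Phi (f (fst z)) (snd z))"
  shows "integrable P (\<lambda>x. cond_surr_loss Phi (f x) (q x))"
    "(\<integral>z. Phi (f (fst z)) (snd z) \<partial>D) = (\<integral>x. cond_surr_loss Phi (f x) (q x) \<partial>P)"
  using integral_disintegrate[OF assms] by (simp_all add: cond_surr_loss_def)

text \<open>This is the nontrivial direction of interchanging infimum and integral: a measurable
  score function must come within \<open>e\<close> of the pointwise infimum at all inputs
  simultaneously.\<close>

lemma opt_risk_Phi_le: "opt_risk_Phi Phi MX D FS \<le> ereal (\<integral>x. best_surr x \<partial>P)"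
proof (rule ereal_le_epsilon2)
  fix e :: real assume e: "0 < e"
  interpret P: prob_space P by (rule prob_space_P)
  obtain d :: "nat \<Rightarrow> real^'r" where d: "\<And>x. best_surr x = (INF i. cond_surr_loss Phi (F *v d i) (q x))"
    using dense_enumeration by blast
  have bm[measurable]: "best_surr \<in> borel_measurable MX" using best_surr_integrable by simp
  define i where "i x = (LEAST i. cond_surr_loss Phi (F *v d i) (q x) < best_surr x + e)" for x
  have i: "cond_surr_loss Phi (F *v d (i x)) (q x) < best_surr x + e" for x
  proof -
    have "(INF i. cond_surr_loss Phi (F *v d i) (q x)) < best_surr x + e" using e d by simp
    then have "\<exists>i. cond_surr_loss Phi (F *v d i) (q x) < best_surr x + e"
      using cond_surr_bdd[of _ "(\<lambda>i. F *v d i) ` UNIV"]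
      by (subst (asm) cINF_less_iff) (auto simp: image_image)
    then show ?thesis unfolding i_def by (rule LeastI_ex)
  qed
  have [measurable]: "i \<in> MX \<rightarrow>\<^sub>M count_space UNIV"
    unfolding i_def by measurable
  define f where "f x = F *v d (i x)" for x
  have fm[measurable]: "f \<in> borel_measurable MX"
    unfolding f_def by (rule measurable_compose_countable) auto
  have ms: "f \<in> measurable_scores MX FS"
    using fm by (simp add: measurable_scores_def f_def)
  \<comment> \<open>Adding \<open>B\<close> makes the integrand nonnegative, so it can be
    disintegrated before it is known to be integrable.\<close>
  have "(\<integral>\<^sup>+z. ennreal (Phi (f (fst z)) (snd z) + B) \<partial>D)
      = (\<integral>\<^sup>+x. (\<Sum>c\<in>UNIV. ennreal (q x $ c) * ennreal (Phi (f x) c + B)) \<partial>P)"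
    by (subst nn_integral_disintegrate) auto
  also have "\<dots> \<le> (\<integral>\<^sup>+x. ennreal (best_surr x + (e + B)) \<partial>P)"
  proof (intro nn_integral_mono)
    fix x
    have pos: "0 \<le> Phi (f x) c + B" for c using Phi_ge[of "f x" c] by simp
    have "(\<Sum>c\<in>UNIV. ennreal (q x $ c) * ennreal (Phi (f x) c + B))
        = ennreal (\<Sum>c\<in>UNIV. q x $ c * (Phi (f x) c + B))"
      using pos q_nonneg by (simp add: sum_ennreal flip: ennreal_mult)
    also have "(\<Sum>c\<in>UNIV. q x $ c * (Phi (f x) c + B)) = cond_surr_loss Phi (f x) (q x) + B"
      by (simp add: distrib_left sum.distrib cond_surr_loss_def q_sum flip: sum_distrib_right)
    also have "ennreal \<dots> \<le> ennreal (best_surr x + (e + B))"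
      using i[of x] by (intro ennreal_leI) (simp add: f_def)
    finally show "(\<Sum>c\<in>UNIV. ennreal (q x $ c) * ennreal (Phi (f x) c + B))
        \<le> ennreal (best_surr x + (e + B))" .
  qed
  also have "\<dots> < \<infinity>"
  proof -
    have "integrable P (\<lambda>x. best_surr x + (e + B))" using best_surr_integrable by auto
    then show ?thesis by (simp add: real_integrable_def less_top)
  qed
  finally have "integrable D (\<lambda>z. Phi (f (fst z)) (snd z) + B)"
    using Phi_ge by (intro integrableI_nonneg) (auto intro!: AE_I2 simp: add.commute[of _ B] minus_le_iff simp flip: diff_le_eq)
  then have int: "integrable D (\<lambda>z. Phi (f (fst z)) (snd z))"
    using Bochner_Integration.integrable_diff[OF _ integrable_const[of B]] by fastforce
  have "opt_risk_Phi Phi MX D FS \<le> risk_Phi Phi D f"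
    unfolding opt_risk_Phi_def by (intro INF_lower ms)
  also have "\<dots> = ereal (\<integral>x. cond_surr_loss Phi (f x) (q x) \<partial>P)"
    using risk_Phi_eq_integral[OF int] cond_surr_eq_integral[OF int] by simp
  also have "(\<integral>x. cond_surr_loss Phi (f x) (q x) \<partial>P) \<le> (\<integral>x. best_surr x + e \<partial>P)"
    using i cond_surr_eq_integral[OF int] best_surr_integrable
    by (intro integral_mono) (auto simp: f_def less_imp_le)
  also have "\<dots> = (\<integral>x. best_surr x \<partial>P) + e"
    using best_surr_integrable by (simp add: P.prob_space[simplified])
  finally show "opt_risk_Phi Phi MX D FS \<le> ereal (\<integral>x. best_surr x \<partial>P) + ereal e" by simp
qed

lemma L_le: "L a b \<le> (\<Sum>a\<in>UNIV. \<Sum>b\<in>UNIV. L a b)"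
proof -
  have "L a b \<le> (\<Sum>b\<in>UNIV. L a b)" by (intro member_le_sum) (auto simp: L_nonneg)
  also have "\<dots> \<le> (\<Sum>a\<in>UNIV. \<Sum>b\<in>UNIV. L a b)"
    by (intro member_le_sum[of _ _ "\<lambda>a. \<Sum>b\<in>UNIV. L a b"]) (auto simp: L_nonneg sum_nonneg)
  finally show ?thesis .
qed

lemma measurable_task_loss:
  assumes [measurable]: "v \<in> borel_measurable N" "y \<in> N \<rightarrow>\<^sub>M count_space UNIV"
  shows "(\<lambda>x. L (pred (v x)) (y x)) \<in> borel_measurable N"
  by (rule measurable_finite_label[of "\<lambda>v. L (pred v)" borel, OF _ assms]) measurable

lemma task_loss_integrable:
  assumes "f \<in> borel_measurable MX"
  shows "integrable D (\<lambda>z. L (pred (f (fst z))) (snd z))"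
  using L_le L_nonneg measurable_task_loss[OF measurable_compose[OF measurable_fst_D assms] measurable_snd_D]
  by (intro integrable_const_bound[of _ "\<Sum>a\<in>UNIV. \<Sum>b\<in>UNIV. L a b"]) auto

lemma risk_L_bounds:
  assumes "f \<in> borel_measurable MX"
  shows "0 \<le> risk_L L D f" "risk_L L D f \<le> (\<Sum>a\<in>UNIV. \<Sum>b\<in>UNIV. L a b)"
  unfolding risk_L_def using L_nonneg L_le
  by (auto intro!: integral_nonneg integral_le_const task_loss_integrable[OF assms])

lemma task_eq_integral:
  assumes "f \<in> borel_measurable MX"
  shows "integrable P (\<lambda>x. cond_task_loss L (f x) (q x))"
    "risk_L L D f = (\<integral>x. cond_task_loss L (f x) (q x) \<partial>P)"
  using integral_disintegrate[OF task_loss_integrable[OF assms]]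
  by (simp_all add: cond_task_loss_def risk_L_def)

lemma cond_task_nonneg: "q' \<in> prob_simplex \<Longrightarrow> 0 \<le> cond_task_loss L f q'"
  unfolding cond_task_loss_def prob_simplex_def by (auto intro!: sum_nonneg mult_nonneg_nonneg L_nonneg)

lemma cond_task_bdd: "q' \<in> prob_simplex \<Longrightarrow> bdd_below ((\<lambda>f. cond_task_loss L f q') ` S)"
  by (intro bdd_belowI[of _ 0]) (auto simp: cond_task_nonneg)

lemma best_task_le: "f \<in> FS \<Longrightarrow> best_task x \<le> cond_task_loss L f (q x)"
  unfolding best_task_def by (intro cINF_lower cond_task_bdd q_simplex)

lemma best_task_nonneg: "0 \<le> best_task x"
  unfolding best_task_def by (intro cINF_greatest cond_task_nonneg q_simplex) auto

lemma best_task_integrable: "integrable P best_task"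
proof -
  \<comment> \<open>The task loss is discontinuous in the score, so the dense-set argument does not
    apply; instead the infimum ranges over a finite set of predictions.\<close>
  have eq: "best_task x = (INF c'\<in>pred ` FS. \<Sum>c\<in>UNIV. q x $ c * L c' c)" for x
    by (simp add: best_task_def cond_task_loss_def image_image)
  have [measurable]: "best_task \<in> borel_measurable MX"
    unfolding eq by (intro borel_measurable_cINF) (auto intro: bdd_below_finite)
  have "integrable P (\<lambda>x. cond_task_loss L 0 (q x))"
    by (rule task_eq_integral) simp
  then show ?thesis
  proof (rule Bochner_Integration.integrable_bound)
    show "AE x in P. norm (best_task x) \<le> norm (cond_task_loss L 0 (q x))"
      using best_task_le[OF zero_in_FS] best_task_nonneg
      by (intro AE_I2) (auto intro: order_trans[OF _ abs_ge_self])
  qed simp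
qed

lemma opt_risk_L_ge: "(\<integral>x. best_task x \<partial>P) \<le> opt_risk_L L MX D FS"
  unfolding opt_risk_L_def
proof (rule cINF_greatest)
  have "(\<lambda>_. 0) \<in> measurable_scores MX FS" by (simp add: measurable_scores_def zero_in_FS)
  then show "measurable_scores MX FS \<noteq> {}" by blast
  fix f assume f: "f \<in> measurable_scores MX FS"
  then have fm: "f \<in> borel_measurable MX" by (simp add: measurable_scores_def)
  show "(\<integral>x. best_task x \<partial>P) \<le> risk_L L D f"
    unfolding task_eq_integral(2)[OF fm]
    using f by (intro integral_mono best_task_integrable task_eq_integral(1) fm best_task_le)
      (simp add: measurable_scores_def)
qed

lemma opt_risk_Phi_finite: "opt_risk_Phi Phi MX D FS < \<infinity>"
  using opt_risk_Phi_le by (auto simp: le_less_trans)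

text \<open>Integrating the pointwise line leaves two integrated infima to be replaced by optimal
  risks. On the task side the easy bound \<open>opt_risk_L_ge\<close> suffices since the slope is
  nonnegative; the surrogate side needs the selection behind \<open>opt_risk_Phi_le\<close>.\<close>

lemma surrogate_comparison:
  assumes line: "\<And>f q'. f \<in> FS \<Longrightarrow> q' \<in> prob_simplex \<Longrightarrow>
      h + c * (excess_task_loss L FS f q' - e) \<le> excess_surr_loss Phi FS f q'"
    and c: "0 \<le> c" and f: "f \<in> measurable_scores MX FS"
    and int: "integrable D (\<lambda>z. Phi (f (fst z)) (snd z))"
    and opt: "opt_risk_Phi Phi MX D FS = ereal r"
  shows "h + c * (risk_L L D f - opt_risk_L L MX D FS - e) \<le> (\<integral>z. Phi (f (fst z)) (snd z) \<partial>D) - r"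
proof -
  interpret P: prob_space P by (rule prob_space_P)
  have fm: "f \<in> borel_measurable MX" and fFS: "\<And>x. x \<in> space MX \<Longrightarrow> f x \<in> FS"
    using f by (auto simp: measurable_scores_def)
  note ints = task_eq_integral(1)[OF fm] best_task_integrable cond_surr_eq_integral(1)[OF int] best_surr_integrable
  have "(\<integral>x. h + c * (cond_task_loss L (f x) (q x) - best_task x - e) \<partial>P)
      \<le> (\<integral>x. cond_surr_loss Phi (f x) (q x) - best_surr x \<partial>P)"
  proof (intro integral_mono)
    fix x assume "x \<in> space P"
    then show "h + c * (cond_task_loss L (f x) (q x) - best_task x - e)
        \<le> cond_surr_loss Phi (f x) (q x) - best_surr x"
      using line[OF fFS q_simplex, of x x]
      by (simp add: excess_task_loss_def excess_surr_loss_def best_task_def best_surr_def)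
  qed (use ints in auto)
  then have "h + c * (risk_L L D f - (\<integral>x. best_task x \<partial>P) - e)
      \<le> (\<integral>z. Phi (f (fst z)) (snd z) \<partial>D) - (\<integral>x. best_surr x \<partial>P)"
    using ints task_eq_integral(2)[OF fm] cond_surr_eq_integral(2)[OF int]
    by (simp add: P.prob_space[simplified])
  moreover have "r \<le> (\<integral>x. best_surr x \<partial>P)" using opt_risk_Phi_le opt by simp
  moreover have "c * (risk_L L D f - opt_risk_L L MX D FS - e) \<le> c * (risk_L L D f - (\<integral>x. best_task x \<partial>P) - e)"
    using opt_risk_L_ge c by (intro mult_left_mono) auto
  ultimately show ?thesis by linarith
qed

end

section \<open>The learning bound\<close>

theorem theorem6:
  fixes L :: "'k::{finite,linorder} \<Rightarrow> 'k::{finite,linorder} \<Rightarrow> real"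
    and F :: "real^'r::finite^'k::{finite,linorder}"
    and psi :: "'x \<Rightarrow> 'h::{real_inner,complete_space}"
    and MX :: "'x measure"
    and D :: "('x \<times> 'k::{finite,linorder}) measure"
    and Phi :: "real^'k::{finite,linorder} \<Rightarrow> 'k::{finite,linorder} \<Rightarrow> real"
    and g :: "real^'k::{finite,linorder} \<Rightarrow> 'k::{finite,linorder} \<Rightarrow> real^'k::{finite,linorder}"
    and Wstar :: "'h \<Rightarrow> real^'r"
    and Hc :: "real \<Rightarrow> real"
    and Rad M eps :: real
    and N :: nat
  assumes L_nonneg: "\<And>c c'. 0 \<le> L c c'"
    and psi_meas: "psi \<in> borel_measurable MX"
    and kernel_meas: "(\<lambda>(x, x'). psi x \<bullet> psi x') \<in> borel_measurable (MX \<Otimes>\<^sub>M MX)"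
    and Phi_cont: "\<And>y. continuous_on UNIV (\<lambda>f. Phi f y)"
    and Phi_convex: "\<And>y. convex_on UNIV (\<lambda>f. Phi f y)"
    and Phi_bdd: "\<And>y. \<exists>b. \<forall>f. b \<le> Phi f y"
    and g_subgrad: "\<And>f f' y. Phi f' y \<ge> Phi f y + g f y \<bullet> (f' - f)"
    and g_meas: "\<And>y. (\<lambda>f. g f y) \<in> borel_measurable borel"
    and D_prob: "prob_space D"
    and D_sets: "sets D = sets (MX \<Otimes>\<^sub>M count_space UNIV)"
    and Rad_pos: "0 < Rad" and M_pos: "0 < M"
    and Wstar_lin: "linear Wstar" and Wstar_hs: "hs_finite Wstar" and Wstar_le: "hs_norm Wstar \<le> Rad"
    and Wstar_opt: "(\<lambda>x. F *v Wstar (psi x)) \<in> measurable_scores MX (range ((*v) F))"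
                   "risk_Phi Phi D (\<lambda>x. F *v Wstar (psi x)) = opt_risk_Phi Phi MX D (range ((*v) F))"
    and grad_bound: "\<And>W. linear W \<Longrightarrow> hs_finite W \<Longrightarrow> hs_norm W \<le> Rad \<Longrightarrow>
        (\<integral>\<^sup>+z. ennreal ((hs_norm (rank_one (transpose F *v g (F *v W (psi (fst z))) (snd z)) (psi (fst z))))\<^sup>2) \<partial>D)
          \<le> ennreal (M\<^sup>2)"
    and Hc_lower: "\<And>e. 0 \<le> e \<Longrightarrow> ereal (Hc e) \<le> calibration_function Phi L (range ((*v) F)) e"
    and Hc_convex: "convex_on {0..} Hc"
    and Hc_mono: "mono_on {0..} Hc"
    and eps_pos: "0 < eps"
    and Hc_eps_pos: "0 < Hc eps"
    and N_large: "real N > 4 * Rad\<^sup>2 * M\<^sup>2 / (Hc eps)\<^sup>2"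
  shows "integrable (PiM {1..N} (\<lambda>_. D))
           (\<lambda>s. risk_L L D (\<lambda>x. F *v asgd_avg F psi g (2 * Rad / (M * sqrt (real N))) Rad N s (psi x)))
       \<and> (\<integral>s. risk_L L D (\<lambda>x. F *v asgd_avg F psi g (2 * Rad / (M * sqrt (real N))) Rad N s (psi x))
             \<partial>PiM {1..N} (\<lambda>_. D))
         < opt_risk_L L MX D (range ((*v) F)) + eps"
proof -
  interpret D: prob_space D by (rule D_prob)
  define c where "c = 2 * Rad / (M * sqrt (real N))"
  have "0 \<le> 4 * Rad\<^sup>2 * M\<^sup>2 / (Hc eps)\<^sup>2" by simp
  with N_large have N: "0 < N" by (cases "N = 0") auto
  have c: "0 < c" using N Rad_pos M_pos by (simp add: c_def)
  \<comment> \<open>With this \<open>c\<close> both summands, divided by \<open>real N\<close>,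
    equal \<open>Rad * M / sqrt (real N)\<close>.\<close>
  have rate: "(4 * Rad\<^sup>2 / (2 * c) + real N * (c * M\<^sup>2 / 2)) / real N < Hc eps"
  proof -
    define n where "n = sqrt (real N)"
    have n: "0 < n" "real N = n\<^sup>2" using N by (auto simp: n_def)
    have "(2 * Rad * M)\<^sup>2 < (Hc eps * n)\<^sup>2"
      using N_large Hc_eps_pos unfolding n by (simp add: field_simps power2_eq_square)
    then have "2 * Rad * M < Hc eps * n"
      by (rule power2_less_imp_less) (use Hc_eps_pos n in auto)
    then show ?thesis
      using n M_pos Rad_pos unfolding c_def n_def[symmetric] n(2)
      by (simp add: field_simps power2_eq_square)
  qed
  obtain b where b: "\<And>y f. b y \<le> Phi f y" using Phi_bdd by metis
  \<comment> \<open>The given lower bounds depend on the label; finiteness of the label type yields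
    a common one.\<close>
  define B where "B = (\<Sum>y\<in>UNIV. \<bar>b y\<bar>)"
  have B: "- B \<le> Phi f y" for f y
  proof -
    have "\<bar>b y\<bar> \<le> B" unfolding B_def by (intro member_le_sum) auto
    then show ?thesis using b[of y f] by linarith
  qed
  obtain q :: "'x \<Rightarrow> real^'k::{finite,linorder}" where q: "q \<in> borel_measurable MX" "\<And>x. q x \<in> prob_simplex"
    "\<And>c. distr (density D (\<lambda>z. ennreal (indicator {c} (snd z)))) MX fst
       = density (distr D MX fst) (\<lambda>x. ennreal (q x $ c))"
    using label_disintegration[OF D_prob D_sets] by blast
  interpret S: surrogate_problem D MX q Phi B L F
    by unfold_locales (fact D_sets q L_nonneg Phi_cont B)+
  \<comment> \<open>The optimal surrogate risk is below infinity by the selection argument, so the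
    operator attaining it has integrable loss.\<close>
  have Wstar_integrable: "integrable D (\<lambda>z. Phi (F *v Wstar (psi (fst z))) (snd z))"
  proof (rule integrable_if_risk_Phi_finite[OF D_prob])
    have [measurable]: "(\<lambda>x. F *v Wstar (psi x)) \<in> borel_measurable MX"
      using Wstar_opt(1) by (simp add: measurable_scores_def)
    show "(\<lambda>z. Phi (F *v Wstar (psi (fst z))) (snd z)) \<in> borel_measurable D" by measurable
    show "risk_Phi Phi D (\<lambda>x. F *v Wstar (psi x)) \<noteq> \<infinity>"
      using S.opt_risk_Phi_finite Wstar_opt(2) by auto
  qed (rule B)
  define r where "r = (\<integral>z. Phi (F *v Wstar (psi (fst z))) (snd z) \<partial>D)"
  have r: "opt_risk_Phi Phi MX D (range ((*v) F)) = ereal r"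
    using risk_Phi_eq_integral[of D Phi "\<lambda>x. F *v Wstar (psi x)", OF Wstar_integrable] Wstar_opt(2)
    by (simp add: r_def)
  interpret A: asgd_problem D MX Phi B F psi g Wstar Rad M c
  proof (intro asgd_problem.intro asgd_problem_axioms.intro)
    fix w :: "'h^'r" assume "norm w \<le> Rad"
    then show "(\<integral>\<^sup>+z. ennreal ((norm (tensor (sgd_grad F psi g w z) (psi (fst z))))\<^sup>2) \<partial>D) \<le> ennreal (M\<^sup>2)"
      using grad_bound[OF linear_hs_op hs_finite_hs_op, of w]
      by (simp add: rank_one_eq_hs_op hs_norm_hs_op sgd_grad_def)
  qed (fact S.labelled_distribution_axioms S.surrogate_loss_axioms psi_meas kernel_meas Phi_convex
      g_subgrad g_meas Rad_pos c Wstar_lin Wstar_hs Wstar_le Wstar_integrable)+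
  obtain a where a: "0 \<le> a" "\<And>u. 0 \<le> u \<Longrightarrow> Hc eps + a * (u - eps) \<le> Hc u"
    using convex_mono_support_line[OF Hc_convex Hc_mono eps_pos] by blast
  have line: "Hc eps + a * (excess_task_loss L (range ((*v) F)) f q' - eps)
      \<le> excess_surr_loss Phi (range ((*v) F)) f q'"
    if f: "f \<in> range ((*v) F)" and q': "q' \<in> prob_simplex" for f q'
  proof -
    let ?e = "excess_task_loss L (range ((*v) F)) f q'"
    have e: "0 \<le> ?e"
      unfolding excess_task_loss_def using cINF_lower[OF S.cond_task_bdd[OF q'] f] by simp
    have "ereal (Hc ?e) \<le> calibration_function Phi L (range ((*v) F)) ?e"
      by (rule Hc_lower[OF e])
    \<comment> \<open>The pair \<open>(f, q')\<close> is itself admissible at the level of its own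
      task excess, so the calibration infimum there is at most its surrogate excess.\<close>
    also have "\<dots> \<le> ereal (excess_surr_loss Phi (range ((*v) F)) f q')"
      unfolding calibration_function_def using f q' by (intro INF_lower2[of "(f, q')"]) auto
    finally show ?thesis using a(2)[OF e] by simp
  qed

  let ?P = "PiM {1..N} (\<lambda>_. D)"
  interpret P: prob_space ?P by (intro prob_space_PiM) unfold_locales
  define avg where "avg s = (1 / real N) *\<^sub>R (\<Sum>t\<in>{1..N}. A.iter s t)" for s
  define risk where "risk s = risk_L L D (\<lambda>x. A.score (avg s) x)" for s
  have norm_avg: "norm (avg s) \<le> Rad" for s
    unfolding avg_def using Rad_pos by (intro norm_sgd_avg) simp
  \<comment> \<open>The bound holds for every sample sequence and is affine in
    \<open>risk s\<close>, so it can be averaged over the samples directly.\<close>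
  have pointwise: "Hc eps + a * (risk s - opt_risk_L L MX D (range ((*v) F)) - eps)
      \<le> (\<Sum>t\<in>{1..N}. A.excess (A.iter s t)) / real N" for s
  proof -
    have "(\<lambda>x. A.score (avg s) x) \<in> measurable_scores MX (range ((*v) F))"
      by (simp add: measurable_scores_def)
    then have "Hc eps + a * (risk s - opt_risk_L L MX D (range ((*v) F)) - eps)
        \<le> (\<integral>z. Phi (A.score (avg s) (fst z)) (snd z) \<partial>D) - r"
      unfolding risk_def
      by (intro S.surrogate_comparison line a(1) A.Phi_score_integrable norm_avg r)
    also have "\<dots> = A.excess (avg s)"
      unfolding A.excess_def r_def
      by (simp add: A.Phi_score_integrable norm_avg Wstar_integrable)
    also have "\<dots> \<le> (\<Sum>t\<in>{1..N}. A.excess (A.iter s t)) / real N"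
      using A.excess_avg_le[of "{1..N}" "A.iter s"] norm_avg[of s] N Rad_pos
      by (simp add: avg_def norm_sgd_iter)
    finally show ?thesis .
  qed
  have int_risk: "integrable ?P risk"
  proof (rule P.integrable_const_bound)
    show "AE s in ?P. norm (risk s) \<le> (\<Sum>a\<in>UNIV. \<Sum>b\<in>UNIV. L a b)"
      using S.risk_L_bounds[OF A.measurable_score_const] by (simp add: risk_def)
    have [measurable]: "(\<lambda>p. A.score (avg (fst p)) (fst (snd p))) \<in> borel_measurable (?P \<Otimes>\<^sub>M D)"
    proof -
      have [measurable]: "(\<lambda>p. hs_op (A.iter (fst p) t) (psi (fst (snd p)))) \<in> borel_measurable (?P \<Otimes>\<^sub>M D)"
        if "t \<in> {1..N}" for t
        using that by (intro A.weakly_measurable_op[OF A.weakly_measurable_iter]) auto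
      \<comment> \<open>The iterates are summed only after evaluation, in \<open>real^'r\<close>,
        where sums of measurable functions are measurable.\<close>
      have "(\<lambda>p. \<Sum>t\<in>{1..N}. hs_op (A.iter (fst p) t) (psi (fst (snd p)))) \<in> borel_measurable (?P \<Otimes>\<^sub>M D)"
        by (intro borel_measurable_sum) measurable
      then show ?thesis unfolding avg_def hs_op_simps hs_op_sum by measurable
    qed
    have "(\<lambda>(s, z). L (pred (A.score (avg s) (fst z))) (snd z)) \<in> borel_measurable (?P \<Otimes>\<^sub>M D)"
      unfolding case_prod_beta' by (rule S.measurable_task_loss) measurable
    then show "risk \<in> borel_measurable ?P"
      unfolding risk_def risk_L_def by (rule D.borel_measurable_lebesgue_integral)
  qed
  have "Hc eps + a * ((\<integral>s. risk s \<partial>?P) - opt_risk_L L MX D (range ((*v) F)) - eps)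
      = (\<integral>s. Hc eps + a * (risk s - opt_risk_L L MX D (range ((*v) F)) - eps) \<partial>?P)"
    using int_risk by (simp add: P.prob_space del: One_nat_def)
  also have "\<dots> \<le> (\<integral>s. (\<Sum>t\<in>{1..N}. A.excess (A.iter s t)) / real N \<partial>?P)"
    using int_risk A.excess_asgd_avg(1)[OF N] by (intro integral_mono pointwise) (auto simp del: One_nat_def)
  also have "\<dots> \<le> (4 * Rad\<^sup>2 / (2 * c) + real N * (c * M\<^sup>2 / 2)) / real N"
    using A.excess_asgd_avg(2)[OF N] by (simp add: divide_right_mono del: One_nat_def)
  also note rate
  finally have "a * ((\<integral>s. risk s \<partial>?P) - opt_risk_L L MX D (range ((*v) F)) - eps) < 0" by simp
  \<comment> \<open>A negative product with nonnegative \<open>a\<close> forces the other factor to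
    be negative; \<open>a = 0\<close> is thereby excluded as contradictory.\<close>
  then have "(\<integral>s. risk s \<partial>?P) < opt_risk_L L MX D (range ((*v) F)) + eps"
    using a(1) mult_nonneg_nonneg[of a] by (smt (verit))
  with int_risk show ?thesis
    unfolding risk_def avg_def asgd_avg_eq c_def by blast
qed

end
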